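(* Let $\hbar,c,m,\beta>0$. For every value of the coupling constant $\gamma\geqslant 0$ (in particular also for $\gamma$ larger than the critical values $\hbar c\beta$ and $\frac{2(2\pi)^{3/2}e^{1/2}}{[\Gamma(1/4)]^4}\,\hbar c\beta$), the quadratic form $$\langle\psi,\boldsymbol{\mathcal B}_{\rm FW}\psi\rangle=\Bigl\langle\psi,\sqrt{-\hbar^2c^2\Delta+m^2c^4}\,\psi\Bigr\rangle-\gamma\,\langle\psi,K_0(\beta|\boldsymbol x|)\psi\rangle ,\qquad\psi\in H^{1/2}(\mathbb R^2;\mathbb C),$$ is bounded from below, i.e. there is a constant $b\in\mathbb R$ (depending on $\gamma$ and the other parameters) such that $\langle\psi,\boldsymbol{\mathcal B}_{\rm FW}\psi\rangle\geqslant -b\,\|\psi\|_2^2$ for all $\psi\in H^{1/2}(\mathbb R^2;\mathbb C)$.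
   Context: $K_0$ is the modified Bessel function of the second kind (Bessel-Macdonald function) of order $0$ and $\Gamma$ is the Gamma function. The Fourier transform is $\widehat\psi(\boldsymbol p)=\int_{\mathbb R^2}e^{i\hbar^{-1}\boldsymbol p\cdot\boldsymbol x}\psi(\boldsymbol x)\,d\boldsymbol x$. The form of $\sqrt{-\hbar^2c^2\Delta+m^2c^4}$ is $\langle\psi,\sqrt{-\hbar^2c^2\Delta+m^2c^4}\,\psi\rangle=(2\pi\hbar)^{-2}\int_{\mathbb R^2}\sqrt{c^2|\boldsymbol p|^2+m^2c^4}\,|\widehat\psi(\boldsymbol p)|^2\,d\boldsymbol p$ on $H^{1/2}(\mathbb R^2;\mathbb C)$, and $\langle\psi,K_0(\beta|\boldsymbol x|)\psi\rangle=\int_{\mathbb R^2}K_0(\beta|\boldsymbol x|)|\psi(\boldsymbol x)|^2\,d\boldsymbol x$. *)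

theory Defs
  imports "HOL-Analysis.Analysis"
begin

text \<open>
  Elements of \<open>L\<^sup>2(\<real>\<^sup>2; \<complex>)\<close> are represented by Borel functions on \<^typ>\<open>real^2\<close>; every
  Lebesgue class has a Borel representative, and everything below depends only on the class.
\<close>

definition square_integrable :: "(real^2 \<Rightarrow> complex) set" where
  "square_integrable =
     {f \<in> borel_measurable lborel. integrable lborel (\<lambda>x. (norm (f x))\<^sup>2)}"

definition L2_norm :: "(real^2 \<Rightarrow> complex) \<Rightarrow> real" where
  "L2_norm f = sqrt (LINT x|lborel. (norm (f x))\<^sup>2)"

definition fourier_integral :: "real \<Rightarrow> (real^2 \<Rightarrow> complex) \<Rightarrow> real^2 \<Rightarrow> complex" where
  "fourier_integral hbar f p = (LINT x|lborel. exp (\<i> * of_real (p \<bullet> x / hbar)) * f x)"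

text \<open>
  The defining integral converges absolutely only for integrable functions. On \<open>L\<^sup>2\<close> the Fourier
  transform is the \<open>L\<^sup>2\<close> limit of the integrals over balls of increasing radius; by Plancherel's
  theorem this limit exists, and it is unique up to null sets. The convergence is stated with the
  nonnegative integral because the Bochner integral of a non-integrable function is \<open>0\<close>.
\<close>

definition has_fourier_transform ::
    "real \<Rightarrow> (real^2 \<Rightarrow> complex) \<Rightarrow> (real^2 \<Rightarrow> complex) \<Rightarrow> bool" where
  "has_fourier_transform hbar f g \<longleftrightarrow>
     f \<in> square_integrable \<and> g \<in> square_integrable \<and>
     (\<lambda>n. \<integral>\<^sup>+ p. ennreal ((norm (fourier_integral hbar
              (\<lambda>x. indicator (cball 0 (real n)) x * f x) p - g p))\<^sup>2) \<partial>lborel)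
       \<longlonglongrightarrow> 0"

definition fourier_transform :: "real \<Rightarrow> (real^2 \<Rightarrow> complex) \<Rightarrow> real^2 \<Rightarrow> complex" where
  "fourier_transform hbar f = (SOME g. has_fourier_transform hbar f g)"

text \<open>
  The space \<open>H\<^sup>s(\<real>\<^sup>2; \<complex>)\<close> for \<open>s \<ge> 0\<close>. It does not depend on the scaling of the Fourier
  transform, so \<open>hbar = 1\<close> is used.
\<close>

definition sobolev_space :: "real \<Rightarrow> (real^2 \<Rightarrow> complex) set" where
  "sobolev_space s =
     {f \<in> square_integrable. \<exists>g. has_fourier_transform 1 f g \<and>
        integrable lborel (\<lambda>p. (1 + (norm p)\<^sup>2) powr s * (norm (g p))\<^sup>2)}"

text \<open>
  The modified Bessel function of the second kind, by its integral representation for \<open>x > 0\<close>.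
  The integral diverges at \<open>x = 0\<close> and is \<open>0\<close> there by convention; as a function of
  \<open>\<bar>x\<bar>\<close> on the plane this affects only a null set.
\<close>

definition bessel_K :: "real \<Rightarrow> real \<Rightarrow> real" where
  "bessel_K \<nu> x = (LINT t:{0..}|lborel. exp (- x * cosh t) * cosh (\<nu> * t))"

definition kinetic_form :: "real \<Rightarrow> real \<Rightarrow> real \<Rightarrow> (real^2 \<Rightarrow> complex) \<Rightarrow> real" where
  "kinetic_form hbar c m \<psi> = (1 / (2 * pi * hbar)\<^sup>2) *
     (LINT p|lborel. sqrt (c\<^sup>2 * (norm p)\<^sup>2 + m\<^sup>2 * c ^ 4) *
        (norm (fourier_transform hbar \<psi> p))\<^sup>2)"

definition potential_form :: "real \<Rightarrow> (real^2 \<Rightarrow> complex) \<Rightarrow> real" where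
  "potential_form \<beta> \<psi> = (LINT x|lborel. bessel_K 0 (\<beta> * norm x) * (norm (\<psi> x))\<^sup>2)"

definition B_FW_form ::
    "real \<Rightarrow> real \<Rightarrow> real \<Rightarrow> real \<Rightarrow> real \<Rightarrow> (real^2 \<Rightarrow> complex) \<Rightarrow> real" where
  "B_FW_form hbar c m \<beta> \<gamma> \<psi> = kinetic_form hbar c m \<psi> - \<gamma> * potential_form \<beta> \<psi>"

end

theory Submission
  imports
    Defs
    "HOL-Probability.Characteristic_Functions"
    "HOL-Real_Asymp.Real_Asymp"
begin

text \<open>
  With \<open>G\<^sub>t\<close> the heat kernel, put \<open>D\<^sub>t = \<integral>\<integral> G\<^sub>t(z) |\<psi>(x + z) - \<psi>(x)|\<^sup>2 dz dx\<close>. The Fourier transform of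
  the Gaussian and Fubini's theorem give, for integrable \<open>\<psi>\<close>, that \<open>D\<^sub>t - D\<^sub>s\<close> is a multiple of
  \<open>\<integral> (exp (- s p\<^sup>2 / 2h\<^sup>2) - exp (- t p\<^sup>2 / 2h\<^sup>2)) |F\<psi>(p)|\<^sup>2 dp\<close>. Since \<open>D\<^sub>s\<close> tends to \<open>0\<close> with \<open>s\<close> (continuity of
  translations in \<open>L\<^sup>2\<close>) and \<open>1 - exp (- u) \<le> \<surd>u\<close>, this yields \<open>D\<^sub>t \<le> C \<surd>t T\<close> with \<open>T\<close> the kinetic energy;
  truncation and Fatou's lemma remove the integrability of \<open>\<psi>\<close>, so that Plancherel's theorem is
  not needed. Averaging \<open>|\<psi>(x)|\<^sup>2 \<le> 2 |\<psi>(x + z)|\<^sup>2 + 2 |\<psi>(x + z) - \<psi>(x)|\<^sup>2\<close> against \<open>G\<^sub>t\<close> bounds the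
  mass of \<open>|\<psi>|\<^sup>2\<close> in a ball of radius \<open>r\<close> by \<open>(r\<^sup>2 / t) \<parallel>\<psi>\<parallel>\<^sup>2 + 2 D\<^sub>t\<close>. Summing this over shrinking dyadic
  balls, with \<open>t\<close> chosen as a power of \<open>r\<close>, bounds \<open>\<integral> |x|\<^sup>-\<^sup>1\<^sup>/\<^sup>2 |\<psi>|\<^sup>2\<close> by \<open>\<epsilon> T + C\<^sub>\<epsilon> \<parallel>\<psi>\<parallel>\<^sup>2\<close> for every
  \<open>\<epsilon> > 0\<close>, and \<open>K\<^sub>0(r) \<le> 2 \<surd>2 r\<^sup>-\<^sup>1\<^sup>/\<^sup>2\<close>.
\<close>

section \<open>The heat kernel\<close>

text \<open>The Gaussian density with covariance \<open>t\<close> times the identity, that is, the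
  kernel of the semigroup generated by half the Laplacian. In this normalisation its Fourier
  transform at v is exp (- t |v|^2 / 2).\<close>

definition heat_kernel :: "real \<Rightarrow> 'a::euclidean_space \<Rightarrow> real" where
  "heat_kernel t z = exp (- (norm z)\<^sup>2 / (2 * t)) / sqrt (2 * pi * t) ^ DIM('a)"

lemma heat_kernel_nonneg [simp]: "t > 0 \<Longrightarrow> heat_kernel t z \<ge> 0"
  by (simp add: heat_kernel_def)

lemma borel_measurable_heat_kernel [measurable]: "heat_kernel t \<in> borel_measurable borel"
  unfolding heat_kernel_def by measurable

text \<open>Since |z|^2 splits over the orthonormal basis, multidimensional Gaussian integrals
  reduce to products of one-dimensional ones.\<close>

lemma heat_kernel_eq_prod:
  assumes "t > 0"
  shows "heat_kernel t (z::'a::euclidean_space) = (\<Prod>b\<in>Basis. normal_density 0 (sqrt t) (z \<bullet> b))"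
proof -
  have "(norm z)\<^sup>2 = (\<Sum>b\<in>Basis. (z \<bullet> b)\<^sup>2)"
    unfolding power2_norm_eq_inner by (subst euclidean_inner) (simp add: power2_eq_square)
  then show ?thesis
    using assms
    by (simp add: heat_kernel_def normal_density_def prod_dividef exp_sum[symmetric]
        sum_negf sum_divide_distrib power_divide)
qed

text \<open>This is the characteristic function of the standard normal law at
  \<open>\<sigma> * v\<close>, after the substitution of u / \<sigma> for u.\<close>

lemma integral_iexp_normal_density:
  assumes "\<sigma> > 0"
  shows "(LINT u|lborel. of_real (normal_density 0 \<sigma> u) * iexp (v * u)) = of_real (exp (- \<sigma>\<^sup>2 * v\<^sup>2 / 2))"
proof -
  have "of_real (exp (- ((\<sigma> * v)^2) / 2)) = char std_normal_distribution (\<sigma> * v)"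
    by (simp add: char_std_normal_distribution)
  also have "\<dots> = (LINT u|lborel. of_real (std_normal_density u) * iexp (\<sigma> * v * u))"
    unfolding char_def by (subst integral_density) (auto simp: scaleR_conv_of_real)
  also have "\<dots> = (LINT u|lborel. inverse \<sigma> *\<^sub>R (of_real (std_normal_density (0 + inverse \<sigma> * u)) * iexp (\<sigma> * v * (0 + inverse \<sigma> * u))))"
    using assms by (subst lborel_integral_real_affine[where c="inverse \<sigma>" and t=0]) auto
  also have "\<dots> = (LINT u|lborel. of_real (normal_density 0 \<sigma> u) * iexp (v * u))"
    using assms by (intro Bochner_Integration.integral_cong refl)
      (simp add: normal_density_def scaleR_conv_of_real field_simps real_sqrt_mult)
  finally show ?thesis by (simp add: power_mult_distrib)
qed

text \<open>Lebesgue measure is the image of the product of its coordinate measures and the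
  integrand is a product over coordinates, so the integral factors. Integrability of the kernel is
  the case v = 0 of the integrability of this product.\<close>

lemma integral_iexp_heat_kernel:
  fixes v :: "'a::euclidean_space"
  assumes t: "t > 0"
  shows "integrable lborel (heat_kernel t :: 'a \<Rightarrow> real)" (is ?A)
    and "(LINT p|lborel. of_real (heat_kernel t p) * iexp (p \<bullet> v)) = of_real (exp (- t * (norm v)\<^sup>2 / 2))" (is ?B)
proof -
  interpret product_sigma_finite "\<lambda>b::'a. lborel :: real measure" ..
  define F where "F v b u = complex_of_real (normal_density 0 (sqrt t) u) * iexp ((v \<bullet> b) * u)" for v b :: 'a and u
  have [measurable]: "F v b \<in> borel_measurable borel" for v b unfolding F_def by measurable
  have prodF: "(\<Prod>b\<in>Basis. F v b (p \<bullet> b)) = of_real (heat_kernel t p) * iexp (p \<bullet> v)" for v p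
    unfolding F_def heat_kernel_eq_prod[OF t] prod.distrib of_real_prod
    by (subst euclidean_inner[of p v]) (simp add: exp_sum[symmetric] sum_distrib_left mult.commute)
  have intF: "integrable lborel (F v b)" for v b
    using t unfolding F_def
    by (intro integrable_mult_indicator Bochner_Integration.integrable_bound[OF integrable_normal_density[of "sqrt t" 0]])
      (auto simp: norm_mult)
  have int: "integrable lborel (\<lambda>p. \<Prod>b\<in>Basis. F v b (p \<bullet> b))" for v
    unfolding lborel_eq[where 'a='a]
    by (subst integrable_distr_eq) (auto intro!: product_integrable_prod intF simp: inner_sum_left inner_Basis if_distrib cong: if_cong)
  from int[of 0] have "integrable lborel (\<lambda>p::'a. complex_of_real (heat_kernel t p))"
    unfolding prodF by simp
  then show ?A using complex_of_real_integrable_eq by blast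
  have "(LINT p|lborel. of_real (heat_kernel t p) * iexp (p \<bullet> v)) = (LINT p|lborel. (\<Prod>b\<in>Basis. F v b (p \<bullet> b)))"
    by (simp add: prodF)
  also have "\<dots> = (\<Prod>b\<in>Basis. LINT u|lborel. F v b u)"
    unfolding lborel_eq[where 'a='a]
    by (subst integral_distr) (auto simp: inner_sum_left inner_Basis if_distrib product_integral_prod[OF _ intF] cong: if_cong)
  also have "\<dots> = (\<Prod>b\<in>Basis. of_real (exp (- t * (v \<bullet> b)\<^sup>2 / 2)))"
    using t unfolding F_def by (subst integral_iexp_normal_density) auto
  also have "\<dots> = of_real (exp (- t * (norm v)\<^sup>2 / 2))"
  proof -
    have "(norm v)\<^sup>2 = (\<Sum>b\<in>Basis. (v \<bullet> b)\<^sup>2)"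
      unfolding power2_norm_eq_inner by (subst euclidean_inner) (simp add: power2_eq_square)
    then show ?thesis
      by (simp add: exp_sum[symmetric] sum_distrib_left sum_negf sum_divide_distrib flip: of_real_prod)
  qed
  finally show ?B .
qed

lemma integral_heat_kernel:
  assumes "t > 0"
  shows "(LINT p|lborel. heat_kernel t (p::'a::euclidean_space)) = 1"
  using integral_iexp_heat_kernel(2)[OF assms, of "0::'a"]
  by simp

lemma nn_integral_heat_kernel:
  assumes "t > 0"
  shows "(\<integral>\<^sup>+p. ennreal (heat_kernel t (p::'a::euclidean_space)) \<partial>lborel) = 1"
  using integral_iexp_heat_kernel(1)[OF assms] assms
  by (subst nn_integral_eq_integral) (auto simp: integral_heat_kernel)

lemma nn_integral_translate:
  fixes c :: "'a::euclidean_space"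
  assumes [measurable]: "f \<in> borel_measurable borel"
  shows "(\<integral>\<^sup>+x. f (c + x) \<partial>lborel) = (\<integral>\<^sup>+x. f x \<partial>lborel)"
  by (subst lborel_distr_plus[of c, symmetric], subst nn_integral_distr) auto

lemma integral_translate:
  fixes c :: "'a::euclidean_space" and f :: "'a \<Rightarrow> 'b::{banach,second_countable_topology}"
  assumes [measurable]: "f \<in> borel_measurable borel"
  shows "(LINT x|lborel. f (c + x)) = (LINT x|lborel. f x)"
  by (subst (2) lborel_distr_plus[of c, symmetric], subst integral_distr) auto

text \<open>Half of the Gaussian exponent is spent on the decay exp (- d^2 / (4 t)). The other half
  is, up to normalisation, the kernel at time 2 t, which has mass 1; \<open>sqrt 2 ^ DIM('a)\<close>
  is the ratio of the two normalisations.\<close>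

lemma nn_integral_heat_kernel_outside_ball:
  assumes t: "t > 0" and d: "d > 0"
  shows "(\<integral>\<^sup>+z\<in>{z. d \<le> norm z}. ennreal (heat_kernel t z) \<partial>(lborel :: 'a::euclidean_space measure))
    \<le> ennreal (sqrt 2 ^ DIM('a) * exp (- d\<^sup>2 / (4 * t)))" (is "(\<integral>\<^sup>+z\<in>?S. _ \<partial>_) \<le> ennreal ?c")
proof -
  have "heat_kernel t z \<le> ?c * heat_kernel (2 * t) z" if "d \<le> norm z" for z :: 'a
  proof -
    have "d\<^sup>2 \<le> (norm z)\<^sup>2" using that d by (intro power_mono) auto
    then have "exp (- (norm z)\<^sup>2 / (2 * t)) \<le> exp (- d\<^sup>2 / (4 * t) + - (norm z)\<^sup>2 / (2 * (2 * t)))"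
      using t by (auto simp: field_simps)
    moreover have sqrt: "sqrt (2 * pi * (2 * t)) ^ DIM('a) = sqrt 2 ^ DIM('a) * sqrt (2 * pi * t) ^ DIM('a)"
      by (simp add: ac_simps flip: real_sqrt_mult power_mult_distrib)
    ultimately have "heat_kernel t z \<le> exp (- d\<^sup>2 / (4 * t) + - (norm z)\<^sup>2 / (2 * (2 * t))) / sqrt (2 * pi * t) ^ DIM('a)"
      unfolding heat_kernel_def using t by (intro divide_right_mono) auto
    also have "\<dots> = ?c * heat_kernel (2 * t) z"
      unfolding heat_kernel_def sqrt exp_add by simp
    finally show ?thesis .
  qed
  then have "(\<integral>\<^sup>+z\<in>?S. ennreal (heat_kernel t z) \<partial>(lborel::'a measure)) \<le> (\<integral>\<^sup>+(z::'a). ennreal ?c * ennreal (heat_kernel (2 * t) z) \<partial>lborel)"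
    using t by (intro nn_integral_mono) (auto simp: indicator_def ennreal_mult'[symmetric] intro!: ennreal_leI)
  also have "\<dots> = ennreal ?c"
    using t by (subst nn_integral_cmult) (auto simp: nn_integral_heat_kernel)
  finally show ?thesis .
qed

section \<open>Continuity of translations\<close>

text \<open>By regularity, A lies between a compact K and an open U with U - K of small measure.
  Once |z| is below the distance from K to the complement of U, shifting a point of K by z or -z
  stays in U, so the two indicators can differ only where x or z + x lies in U - K.\<close>

lemma tendsto_L1_translate_indicator:
  fixes A :: "'a::euclidean_space set"
  assumes A: "A \<in> sets borel" "emeasure lborel A < \<infinity>" and e: "e > 0"
  shows "\<forall>\<^sub>F z in at 0. (\<integral>\<^sup>+x. ennreal \<bar>indicator A (z + x) - indicator A x\<bar> \<partial>lborel) < ennreal e"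
proof -
  have AL: "A \<in> sets lebesgue" using A by simp
  obtain U where U: "open U" "A \<subseteq> U" "emeasure lborel (U - A) < e/8"
    by (rule outer_regular_lborel[OF A(1), of "e/8"]) (use e in auto)
  obtain C where C: "closed C" "C \<subseteq> A" "emeasure lebesgue (A - C) < ennreal (e/16)"
    by (rule sets_lebesgue_inner_closed[OF AL, of "e/16"]) (use e in auto)
  have CA: "emeasure lborel (A - C) < e/16"
  proof -
    have "A - C \<in> sets lborel" using C A by (simp add: borel_closed)
    then show ?thesis using C(3) by (simp del: sets_lborel add: emeasure_completion)
  qed
  \<comment> \<open>Cutting the closed inner set by large balls makes it compact, which gives a
    positive distance from the complement of \<open>U\<close>.\<close>
  define K where "K n = C \<inter> cball 0 (real n)" for n
  have [measurable]: "A \<in> sets borel" "C \<in> sets borel" "U \<in> sets borel" "K n \<in> sets borel" for n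
    using A U C by (auto simp: K_def)
  have "(\<lambda>n. emeasure lborel (A - K n)) \<longlonglongrightarrow> emeasure lborel (\<Inter>n. A - K n)"
  proof (rule Lim_emeasure_decseq)
    show "decseq (\<lambda>n. A - K n)" unfolding K_def decseq_def by auto
    show "emeasure lborel (A - K n) \<noteq> \<infinity>" for n
      using A(2) emeasure_mono[of "A - K n" A lborel] by (auto simp: top_unique)
  qed auto
  moreover have "(\<Inter>n. A - K n) = A - C"
    unfolding K_def by (auto simp: real_arch_simple)
  ultimately have "\<forall>\<^sub>F n in sequentially. emeasure lborel (A - K n) < e/16"
    using CA by (auto simp: order_tendsto_iff)
  then obtain n where n: "emeasure lborel (A - K n) < e/16"
    by (meson eventually_happens trivial_limit_sequentially)
  have cK: "compact (K n)" unfolding K_def using C by (intro closed_Int_compact) auto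
  have "K n \<inter> - U = {}" using C U by (auto simp: K_def)
  from separate_compact_closed[OF cK _ this] U(1) obtain d
    where d: "d > 0" "\<And>x y. x \<in> K n \<Longrightarrow> y \<in> -U \<Longrightarrow> d \<le> dist x y"
    by (meson closed_Compl)
  have UK: "emeasure lborel (U - K n) \<le> e/4"
  proof -
    have "U - K n = (U - A) \<union> (A - K n)" using C U by (auto simp: K_def)
    then have "emeasure lborel (U - K n) \<le> emeasure lborel (U - A) + emeasure lborel (A - K n)"
      by (auto intro!: emeasure_subadditive)
    also have "\<dots> \<le> ennreal (e/8) + ennreal (e/16)" using n U by (intro add_mono) auto
    also have "\<dots> \<le> ennreal (e/4)" using e by (simp flip: ennreal_plus)
    finally show ?thesis .
  qed
  show ?thesis
    unfolding eventually_at
  proof (intro exI[of _ d] conjI ballI impI)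
    fix z :: 'a assume z: "z \<noteq> 0 \<and> dist z 0 < d"
    have in_U: "z + x \<in> U \<and> x - z \<in> U" if "x \<in> K n" for x
      using d(2)[OF that, of "z + x"] d(2)[OF that, of "x - z"] z by (auto simp: dist_norm)
    have pw: "\<bar>indicator A (z + x) - indicator A x\<bar> \<le> (indicator (U - K n) (z + x) + indicator (U - K n) x :: real)" for x
    proof -
      have "K n \<subseteq> A" using C by (auto simp: K_def)
      moreover have "z + x - z = x" by simp
      ultimately show ?thesis
        using in_U[of x] in_U[of "z + x"] U(2) by (simp add: indicator_def) blast
    qed
    have "(\<integral>\<^sup>+x. ennreal \<bar>indicator A (z + x) - indicator A x\<bar> \<partial>lborel)
        \<le> (\<integral>\<^sup>+x. ennreal (indicator (U - K n) (z + x)) + ennreal (indicator (U - K n) x) \<partial>lborel)"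
      using pw by (intro nn_integral_mono) (auto intro!: ennreal_leI simp flip: ennreal_plus)
    also have "\<dots> = emeasure lborel (U - K n) + emeasure lborel (U - K n)"
      by (simp add: nn_integral_add nn_integral_translate[where f="indicator (U - K n)"] ennreal_indicator)
    also have "\<dots> \<le> ennreal (e/4) + ennreal (e/4)" using UK by (intro add_mono)
    also have "\<dots> < ennreal e" using e by (simp add: ennreal_less_iff flip: ennreal_plus)
    finally show "(\<integral>\<^sup>+x. ennreal \<bar>indicator A (z + x) - indicator A x\<bar> \<partial>lborel) < ennreal e" .
  qed fact
qed


lemma ennreal_tendsto_0I:
  fixes f :: "'a \<Rightarrow> ennreal"
  assumes "\<And>e::real. e > 0 \<Longrightarrow> \<forall>\<^sub>F x in F. f x \<le> ennreal e"
  shows "(f \<longlongrightarrow> 0) F"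
proof (rule order_tendstoI)
  fix a :: ennreal assume "0 < a"
  then obtain e where e: "0 < ennreal e" "ennreal e < a"
    by (metis dense ennreal_cases not_less top_greatest)
  then show "\<forall>\<^sub>F x in F. f x < a"
    using assms[of e] by (auto elim!: eventually_mono)
qed simp

text \<open>Induction over integrable functions, starting from indicators. In the limit case
  translation invariance makes the approximation error of the shifted function equal to that of the
  unshifted one, hence uniform in z.\<close>

lemma tendsto_L1_translate:
  fixes f :: "'a::euclidean_space \<Rightarrow> 'b::{banach,second_countable_topology}"
  assumes "integrable lborel f"
  shows "((\<lambda>z. \<integral>\<^sup>+x. ennreal (norm (f (z + x) - f x)) \<partial>lborel) \<longlongrightarrow> 0) (at 0)"
  using assms
proof induction
  case (base A c)
  then have [measurable]: "A \<in> sets borel" by simp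
  have "((\<lambda>z. \<integral>\<^sup>+x. ennreal \<bar>indicator A (z + x) - indicator A x\<bar> \<partial>lborel) \<longlongrightarrow> 0) (at 0)"
    using base by (intro ennreal_tendsto_0I eventually_mono[OF tendsto_L1_translate_indicator] less_imp_le) auto
  from ennreal_tendsto_cmult[OF _ this, of "ennreal (norm c)"]
  have "((\<lambda>z. \<integral>\<^sup>+x. ennreal (norm c) * ennreal \<bar>indicator A (z + x) - indicator A x\<bar> \<partial>lborel) \<longlongrightarrow> 0) (at 0)"
    by (simp add: nn_integral_cmult)
  moreover have "ennreal (norm (indicator A (z + x) *\<^sub>R c - indicator A x *\<^sub>R c))
      = ennreal (norm c) * ennreal \<bar>indicator A (z + x) - indicator A x\<bar>" for z x
    by (simp flip: scaleR_diff_left add: ennreal_mult' mult.commute)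
  ultimately show ?case by simp
next
  case (add f g)
  have [measurable]: "f \<in> borel_measurable borel" "g \<in> borel_measurable borel"
    using add by auto
  show ?case
  proof (rule tendsto_sandwich[OF _ _ tendsto_const])
    show "((\<lambda>z. (\<integral>\<^sup>+x. ennreal (norm (f (z + x) - f x)) \<partial>lborel) + (\<integral>\<^sup>+x. ennreal (norm (g (z + x) - g x)) \<partial>lborel)) \<longlongrightarrow> 0) (at 0)"
      using tendsto_add[OF add.IH] by simp
    have "norm (f (z + x) + g (z + x) - (f x + g x)) \<le> norm (f (z + x) - f x) + norm (g (z + x) - g x)" for z x
      by (metis add_diff_add norm_triangle_ineq)
    then show "\<forall>\<^sub>F z in at 0. (\<integral>\<^sup>+x. ennreal (norm (f (z + x) + g (z + x) - (f x + g x))) \<partial>lborel)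
      \<le> (\<integral>\<^sup>+x. ennreal (norm (f (z + x) - f x)) \<partial>lborel) + (\<integral>\<^sup>+x. ennreal (norm (g (z + x) - g x)) \<partial>lborel)"
      by (intro always_eventually allI, subst nn_integral_add[symmetric])
        (auto intro!: nn_integral_mono ennreal_leI simp flip: ennreal_plus)
  qed simp
next
  case (lim f s)
  have [measurable]: "f \<in> borel_measurable borel" "s i \<in> borel_measurable borel" for i
    using lim by auto
  have "(\<lambda>i. \<integral>\<^sup>+x. ennreal (norm (f x - s i x)) \<partial>lborel) \<longlonglongrightarrow> 0"
  proof (rule nn_integral_dominated_convergence_norm[where w="\<lambda>x. 2 * norm (f x)"])
    show "(\<integral>\<^sup>+x. ennreal (2 * norm (f x)) \<partial>lborel) < \<infinity>"
      using integrable_mult_right[OF integrable_norm[OF lim.hyps(4)], of 2]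
      unfolding integrable_iff_bounded by simp
  qed (use lim in auto)
  then have small: "\<forall>\<^sub>F i in sequentially. (\<integral>\<^sup>+x. ennreal (norm (f x - s i x)) \<partial>lborel) < a" if "a > 0" for a
    using that by (auto simp: order_tendsto_iff)
  show ?case
  proof (rule ennreal_tendsto_0I)
    fix e :: real assume e: "e > 0"
    obtain i where i: "(\<integral>\<^sup>+x. ennreal (norm (f x - s i x)) \<partial>lborel) < ennreal (e/4)"
      using small[of "ennreal (e/4)"] e by (meson divide_pos_pos ennreal_less_zero_iff eventually_happens trivial_limit_sequentially zero_less_numeral)
    have "\<forall>\<^sub>F z in at 0. (\<integral>\<^sup>+x. ennreal (norm (s i (z + x) - s i x)) \<partial>lborel) < ennreal (e/4)"
      using lim.IH[of i] e by (auto simp: order_tendsto_iff)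
    then show "\<forall>\<^sub>F z in at 0. (\<integral>\<^sup>+x. ennreal (norm (f (z + x) - f x)) \<partial>lborel) \<le> ennreal e"
    proof eventually_elim
      case (elim z)
      have "norm (f (z + x) - f x) \<le> norm (f (z + x) - s i (z + x)) + (norm (s i (z + x) - s i x) + norm (f x - s i x))" for x
        by norm
      then have "(\<integral>\<^sup>+x. ennreal (norm (f (z + x) - f x)) \<partial>lborel)
        \<le> (\<integral>\<^sup>+x. ennreal (norm (f (z + x) - s i (z + x))) + (ennreal (norm (s i (z + x) - s i x)) + ennreal (norm (f x - s i x))) \<partial>lborel)"
        by (intro nn_integral_mono) (auto intro!: ennreal_leI simp flip: ennreal_plus)
      also have "\<dots> = (\<integral>\<^sup>+x. ennreal (norm (f x - s i x)) \<partial>lborel) + ((\<integral>\<^sup>+x. ennreal (norm (s i (z + x) - s i x)) \<partial>lborel)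
           + (\<integral>\<^sup>+x. ennreal (norm (f x - s i x)) \<partial>lborel))"
        by (simp add: nn_integral_add nn_integral_translate[where f="\<lambda>x. ennreal (norm (f x - s i x))"])
      also have "\<dots> \<le> ennreal (e/4) + (ennreal (e/4) + ennreal (e/4))"
        using i elim by (intro add_mono) auto
      also have "\<dots> \<le> ennreal e" using e by (simp flip: ennreal_plus)
      finally show ?case .
    qed
  qed
qed

text \<open>
  The map \<open>a \<mapsto> \<parallel>a\<parallel> a\<close> carries \<open>L\<^sup>2\<close> to \<open>L\<^sup>1\<close>, and its inverse is Hoelder continuous by this inequality.
\<close>

lemma norm_diff_power2_le_norm_scaleR_diff:
  fixes a b :: "'a::real_inner"
  shows "(norm (a - b))\<^sup>2 \<le> 2 * norm (norm a *\<^sub>R a - norm b *\<^sub>R b)"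
proof (cases "a = b")
  case False
  have sq: "(norm (a - b))\<^sup>2 = (norm a)\<^sup>2 + (norm b)\<^sup>2 - 2 * (a \<bullet> b)"
    by (simp add: power2_norm_eq_inner inner_diff_left inner_diff_right inner_commute)
  have "norm (a - b) * (norm (a - b))\<^sup>2 \<le> (norm a + norm b) * (norm (a - b))\<^sup>2"
    by (intro mult_right_mono norm_triangle_ineq4) auto
  \<comment> \<open>The added nonnegative term completes the expression to an inner product with
    \<open>a - b\<close>. Cauchy-Schwarz then leaves one factor \<open>norm (a - b)\<close> to
    cancel.\<close>
  also have "\<dots> \<le> (norm a + norm b) * (norm (a - b))\<^sup>2 + (norm a + norm b) * (norm a - norm b)\<^sup>2"
    by simp
  also have "\<dots> = 2 * ((norm a *\<^sub>R a - norm b *\<^sub>R b) \<bullet> (a - b))"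
    unfolding sq
    by (simp add: inner_diff_left inner_diff_right inner_commute[of b a] flip: power2_norm_eq_inner)
      (simp add: power2_eq_square algebra_simps)
  also have "\<dots> \<le> 2 * (norm (norm a *\<^sub>R a - norm b *\<^sub>R b) * norm (a - b))"
    by (intro mult_left_mono norm_cauchy_schwarz) auto
  finally show ?thesis
    using False by (simp add: mult.commute mult.assoc)
qed simp

text \<open>The function |f| f has modulus |f|^2 and is therefore integrable, so the L1 statement
  applies to it; the preceding inequality carries the result back to f.\<close>

lemma tendsto_L2_translate:
  fixes f :: "'a::euclidean_space \<Rightarrow> 'b::{real_inner,banach,second_countable_topology}"
  assumes [measurable]: "f \<in> borel_measurable borel" and int: "integrable lborel (\<lambda>x. (norm (f x))\<^sup>2)"
  shows "((\<lambda>z. \<integral>\<^sup>+x. ennreal ((norm (f (z + x) - f x))\<^sup>2) \<partial>lborel) \<longlongrightarrow> 0) (at 0)"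
proof (rule tendsto_sandwich[OF _ _ tendsto_const])
  let ?g = "\<lambda>x. norm (f x) *\<^sub>R f x"
  have "integrable lborel ?g"
    by (rule Bochner_Integration.integrable_bound[OF int]) (auto simp: power2_eq_square)
  from ennreal_tendsto_cmult[OF _ tendsto_L1_translate[OF this], of 2]
  show "((\<lambda>z. 2 * (\<integral>\<^sup>+x. ennreal (norm (?g (z + x) - ?g x)) \<partial>lborel)) \<longlongrightarrow> 0) (at 0)"
    by simp
  show "\<forall>\<^sub>F z in at 0. (\<integral>\<^sup>+x. ennreal ((norm (f (z + x) - f x))\<^sup>2) \<partial>lborel)
      \<le> 2 * (\<integral>\<^sup>+x. ennreal (norm (?g (z + x) - ?g x)) \<partial>lborel)"
  proof (intro always_eventually allI)
    fix z
    have "(\<integral>\<^sup>+x. ennreal ((norm (f (z + x) - f x))\<^sup>2) \<partial>lborel) \<le> (\<integral>\<^sup>+x. 2 * ennreal (norm (?g (z + x) - ?g x)) \<partial>lborel)"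
    proof (intro nn_integral_mono)
      fix x
      have "ennreal ((norm (f (z + x) - f x))\<^sup>2) \<le> ennreal (2 * norm (?g (z + x) - ?g x))"
        by (intro ennreal_leI norm_diff_power2_le_norm_scaleR_diff)
      then show "ennreal ((norm (f (z + x) - f x))\<^sup>2) \<le> 2 * ennreal (norm (?g (z + x) - ?g x))"
        by (simp add: ennreal_mult')
    qed
    then show "(\<integral>\<^sup>+x. ennreal ((norm (f (z + x) - f x))\<^sup>2) \<partial>lborel)
      \<le> 2 * (\<integral>\<^sup>+x. ennreal (norm (?g (z + x) - ?g x)) \<partial>lborel)"
      by (simp add: nn_integral_cmult)
  qed
qed simp

section \<open>Mean square deviation under the heat kernel\<close>

lemma norm_diff_power2_le:
  fixes a b :: "'a::real_normed_vector"
  shows "(norm (a - b))\<^sup>2 \<le> 2 * (norm a)\<^sup>2 + 2 * (norm b)\<^sup>2"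
proof -
  have "(norm (a - b))\<^sup>2 \<le> (norm a + norm b)\<^sup>2"
    by (intro power_mono norm_triangle_ineq4) auto
  also have "\<dots> \<le> 2 * (norm a)\<^sup>2 + 2 * (norm b)\<^sup>2"
    using zero_le_power2[of "norm a - norm b"] by (simp add: power2_eq_square algebra_simps)
  finally show ?thesis .
qed

text \<open>For square integrable f this is twice the quadratic form of 1 - exp (t Laplacian / 2).
  As an iterated nonnegative integral it is meaningful for every measurable f.\<close>

definition heat_deviation :: "real \<Rightarrow> ('a::euclidean_space \<Rightarrow> 'b::real_normed_vector) \<Rightarrow> ennreal" where
  "heat_deviation t f =
     (\<integral>\<^sup>+x. (\<integral>\<^sup>+z. ennreal (heat_kernel t z * (norm (f (z + x) - f x))\<^sup>2) \<partial>lborel) \<partial>lborel)"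

text \<open>By Fubini the deviation is the average of the squared L2 distance \<open>T z\<close>
  against the heat kernel. Near the origin \<open>T\<close> is small by continuity of translations;
  elsewhere it is at most 4 times the squared norm, and the Gaussian tail vanishes as t tends to
  0.\<close>

lemma tendsto_heat_deviation:
  fixes f :: "'a::euclidean_space \<Rightarrow> 'b::{real_inner,banach,second_countable_topology}"
  assumes [measurable]: "f \<in> borel_measurable borel" and int: "integrable lborel (\<lambda>x. (norm (f x))\<^sup>2)"
  shows "((\<lambda>t. heat_deviation t f) \<longlongrightarrow> 0) (at_right 0)"
proof (rule ennreal_tendsto_0I)
  fix e :: real assume e: "e > 0"
  define T where "T z = (\<integral>\<^sup>+x. ennreal ((norm (f (z + x) - f x))\<^sup>2) \<partial>lborel)" for z
  define N where "N = (LINT x|lborel. (norm (f x))\<^sup>2)"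
  have N: "(\<integral>\<^sup>+x. ennreal ((norm (f x))\<^sup>2) \<partial>lborel) = ennreal N" "N \<ge> 0"
    using int by (auto simp: N_def nn_integral_eq_integral)
  have [measurable]: "T \<in> borel_measurable borel" unfolding T_def by measurable
  have T_le: "T z \<le> ennreal (4 * N)" for z
  proof -
    have "T z \<le> (\<integral>\<^sup>+x. 2 * ennreal ((norm (f (z + x)))\<^sup>2) + 2 * ennreal ((norm (f x))\<^sup>2) \<partial>lborel)"
      unfolding T_def
    proof (intro nn_integral_mono)
      fix x
      have "ennreal ((norm (f (z + x) - f x))\<^sup>2) \<le> ennreal (2 * (norm (f (z + x)))\<^sup>2 + 2 * (norm (f x))\<^sup>2)"
        by (intro ennreal_leI norm_diff_power2_le)
      then show "ennreal ((norm (f (z + x) - f x))\<^sup>2) \<le> 2 * ennreal ((norm (f (z + x)))\<^sup>2) + 2 * ennreal ((norm (f x))\<^sup>2)"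
        by (simp add: ennreal_mult')
    qed
    also have "\<dots> = 2 * ennreal N + 2 * ennreal N"
      by (simp add: nn_integral_add nn_integral_cmult nn_integral_translate[where f="\<lambda>x. ennreal ((norm (f x))\<^sup>2)"] N)
    also have "\<dots> = ennreal (4 * N)" using N(2) by (simp add: ennreal_mult' flip: distrib_right)
    finally show ?thesis .
  qed
  have "(T \<longlongrightarrow> 0) (at 0)" unfolding T_def by (rule tendsto_L2_translate) fact+
  then have "\<forall>\<^sub>F z in at 0. T z < ennreal (e/2)" using e by (auto simp: order_tendsto_iff)
  then obtain d where d: "d > 0" "\<And>z. z \<noteq> 0 \<Longrightarrow> dist z 0 < d \<Longrightarrow> T z < ennreal (e/2)"
    by (auto simp: eventually_at)
  \<comment> \<open>The limit along \<open>at 0\<close> says nothing about z = 0 itself.\<close>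
  have T0: "T 0 = 0" by (simp add: T_def)
  have T_small: "T z \<le> ennreal (e/2)" if "norm z < d" for z
    using d(2)[of z] that T0 by (cases "z = 0") auto
  let ?c = "\<lambda>t. sqrt 2 ^ DIM('a) * exp (- d\<^sup>2 / (4 * t))"
  have bound: "heat_deviation t f \<le> ennreal (e/2 + 4 * N * ?c t)" if t: "t > 0" for t
  proof -
    have "heat_deviation t f = (\<integral>\<^sup>+z. (\<integral>\<^sup>+x. ennreal (heat_kernel t z * (norm (f (z + x) - f x))\<^sup>2) \<partial>lborel) \<partial>lborel)"
      unfolding heat_deviation_def by (rule lborel_pair.Fubini') measurable
    also have "\<dots> = (\<integral>\<^sup>+z. ennreal (heat_kernel t z) * T z \<partial>lborel)"
      unfolding T_def using t by (intro nn_integral_cong) (simp add: ennreal_mult nn_integral_cmult)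
    also have "\<dots> \<le> (\<integral>\<^sup>+(z::'a). ennreal (e/2) * ennreal (heat_kernel t z) + ennreal (4 * N) * (ennreal (heat_kernel t z) * indicator {z. d \<le> norm z} z) \<partial>lborel)"
    proof (intro nn_integral_mono)
      fix z :: 'a
      show "ennreal (heat_kernel t z) * T z \<le> ennreal (e/2) * ennreal (heat_kernel t z) + ennreal (4 * N) * (ennreal (heat_kernel t z) * indicator {z. d \<le> norm z} z)"
      proof (cases "norm z < d")
        case True
        then show ?thesis using mult_left_mono[OF T_small[OF True], of "ennreal (heat_kernel t z)"] by (simp add: mult.commute)
      next
        case False
        then show ?thesis using mult_left_mono[OF T_le[of z], of "ennreal (heat_kernel t z)"]
          by (simp add: mult.commute add_increasing)
      qed
    qed
    also have "\<dots> = ennreal (e/2) + ennreal (4 * N) * (\<integral>\<^sup>+z\<in>{z. d \<le> norm z}. ennreal (heat_kernel t z) \<partial>(lborel::'a measure))"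
      using t by (simp add: nn_integral_add nn_integral_cmult nn_integral_heat_kernel)
    also have "\<dots> \<le> ennreal (e/2) + ennreal (4 * N) * ennreal (?c t)"
      using nn_integral_heat_kernel_outside_ball[OF t d(1), where 'a='a] by (intro add_left_mono mult_left_mono) auto
    also have "\<dots> = ennreal (e/2 + 4 * N * ?c t)"
      using e N(2) by (simp add: ennreal_mult ennreal_plus)
    finally show ?thesis .
  qed
  have "filterlim (\<lambda>t. - d\<^sup>2 / (4 * t)) at_bot (at_right 0)"
    using d(1) by real_asymp
  then have "((\<lambda>t. exp (- d\<^sup>2 / (4 * t))) \<longlongrightarrow> 0) (at_right 0)"
    by (rule filterlim_compose[OF exp_at_bot])
  then have "((\<lambda>t. e/2 + 4 * N * (sqrt 2 ^ DIM('a) * exp (- d\<^sup>2 / (4 * t)))) \<longlongrightarrow> e/2 + 4 * N * (sqrt 2 ^ DIM('a) * 0)) (at_right 0)"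
    by (intro tendsto_intros)
  then have "\<forall>\<^sub>F t in at_right 0. e/2 + 4 * N * ?c t < e"
    using e by (auto simp: order_tendsto_iff)
  then show "\<forall>\<^sub>F t in at_right 0. heat_deviation t f \<le> ennreal e"
    using eventually_at_right_less[of 0]
  proof eventually_elim
    case (elim t)
    then show ?case using bound[of t] by (meson ennreal_leI less_imp_le order_trans)
  qed
qed

section \<open>The heat deviation and the Fourier transform\<close>

lemma borel_measurable_cnj [measurable]: "cnj \<in> borel_measurable borel"
  by (intro borel_measurable_continuous_onI continuous_intros)

text \<open>The inner integral of the modulus is |f(x)| times the L1 norm of f, by translation
  invariance. This joint integrability justifies the later exchanges of integrals.\<close>

lemma integrable_autocorrelation:
  fixes f :: "'a::euclidean_space \<Rightarrow> complex"
  assumes f: "integrable lborel f"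
  shows "integrable (lborel \<Otimes>\<^sub>M lborel) (\<lambda>(x, z). f (z + x) * cnj (f x))"
proof (rule lborel_pair.Fubini_integrable)
  have [measurable]: "f \<in> borel_measurable borel" using f by auto
  show "(\<lambda>(x, z). f (z + x) * cnj (f x)) \<in> borel_measurable (lborel \<Otimes>\<^sub>M lborel)" by measurable
  have tr: "(LINT z|lborel. norm (f (z + x))) = (LINT z|lborel. norm (f z))" for x
    using integral_translate[of "\<lambda>z. norm (f z)" x] by (simp add: add.commute)
  show "integrable lborel (\<lambda>x. LINT z|lborel. norm (case (x, z) of (x, z) \<Rightarrow> f (z + x) * cnj (f x)))"
    using f by (simp add: norm_mult tr)
  have "integrable lborel (\<lambda>z. f (z + x))" for x
    unfolding integrable_iff_bounded
    using f nn_integral_translate[of "\<lambda>z. ennreal (norm (f z))" x]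
    by (auto simp: integrable_iff_bounded add.commute)
  then show "AE x in lborel. integrable lborel (\<lambda>z. case (x, z) of (x, z) \<Rightarrow> f (z + x) * cnj (f x))"
    by auto
qed

lemma borel_measurable_fourier_integral [measurable]:
  assumes [measurable]: "f \<in> borel_measurable borel"
  shows "fourier_integral hbar f \<in> borel_measurable borel"
  unfolding fourier_integral_def by measurable

lemma norm_fourier_integral_le:
  assumes "integrable lborel f"
  shows "norm (fourier_integral hbar f p) \<le> (LINT x|lborel. norm (f x))"
proof -
  have "norm (fourier_integral hbar f p) \<le> (LINT x|lborel. norm (exp (\<i> * of_real (p \<bullet> x / hbar)) * f x))"
    unfolding fourier_integral_def by (rule integral_norm_bound)
  then show ?thesis by (simp only: norm_mult norm_exp_i_times) simp
qed

text \<open>The squared modulus of a transform is the transform of the autocorrelation. Shifting the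
  variable by x moves the phase exp (- i p x / hbar) onto the transform; multiplying by the
  conjugate of f(x) and integrating in x produces the second factor.\<close>

lemma norm_fourier_integral_power2_eq:
  assumes f: "integrable lborel f"
  shows "of_real ((norm (fourier_integral hbar f p))\<^sup>2)
    = (LINT (x, z)|(lborel \<Otimes>\<^sub>M lborel). f (z + x) * cnj (f x) * iexp (p \<bullet> z / hbar))"
proof -
  have [measurable]: "f \<in> borel_measurable borel" using f by auto
  let ?F = "fourier_integral hbar f p"
  have F: "iexp (- (p \<bullet> x / hbar)) * ?F = (LINT z|lborel. f (z + x) * iexp (p \<bullet> z / hbar))" for x
  proof -
    have "?F = (LINT z|lborel. iexp (p \<bullet> (x + z) / hbar) * f (x + z))"
      unfolding fourier_integral_def by (rule integral_translate[symmetric]) measurable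
    then have "iexp (- (p \<bullet> x / hbar)) * ?F = (LINT z|lborel. iexp (- (p \<bullet> x / hbar)) * (iexp (p \<bullet> (x + z) / hbar) * f (x + z)))"
      by simp
    also have "\<dots> = (LINT z|lborel. f (z + x) * iexp (p \<bullet> z / hbar))"
      by (intro Bochner_Integration.integral_cong refl)
        (simp add: inner_add_right add_divide_distrib distrib_left exp_add exp_minus add.commute)
    finally show ?thesis .
  qed
  have "of_real ((norm ?F)\<^sup>2) = cnj ?F * ?F"
    by (subst complex_norm_square) (rule mult.commute)
  also have "cnj ?F = (LINT x|lborel. cnj (f x) * iexp (- (p \<bullet> x / hbar)))"
    unfolding fourier_integral_def
    by (simp add: exp_cnj mult.commute flip: Bochner_Integration.integral_cnj)
  also have "\<dots> * ?F = (LINT x|lborel. cnj (f x) * iexp (- (p \<bullet> x / hbar)) * ?F)"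
    by simp
  also have "\<dots> = (LINT x|lborel. (LINT z|lborel. f (z + x) * cnj (f x) * iexp (p \<bullet> z / hbar)))"
    unfolding mult.assoc F
    by (subst integral_mult_right_zero[symmetric]) (simp add: ac_simps)
  also have "\<dots> = (LINT (x, z)|(lborel \<Otimes>\<^sub>M lborel). f (z + x) * cnj (f x) * iexp (p \<bullet> z / hbar))"
  proof (rule lborel_pair.integral_fst)
    show "integrable (lborel \<Otimes>\<^sub>M lborel) (\<lambda>(x, z). f (z + x) * cnj (f x) * iexp (p \<bullet> z / hbar))"
      by (rule Bochner_Integration.integrable_bound[OF integrable_autocorrelation[OF f]])
        (auto simp: norm_mult)
  qed
  finally show ?thesis .
qed

text \<open>With a Gaussian weight in p the triple integral converges absolutely, so the
  p-integration can be done first; it is the Fourier transform of the Gaussian, evaluated at z /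
  hbar.\<close>

lemma integral_heat_kernel_norm_fourier_integral:
  assumes f: "integrable lborel f" and h: "hbar > 0" and s: "s > 0"
  shows "of_real (LINT p|lborel. heat_kernel s p * (norm (fourier_integral hbar f p))\<^sup>2)
    = (LINT (x, z)|(lborel \<Otimes>\<^sub>M lborel). f (z + x) * cnj (f x) * of_real (exp (- s * (norm z / hbar)\<^sup>2 / 2)))"
proof -
  have [measurable]: "f \<in> borel_measurable borel" using f by auto
  interpret P: pair_sigma_finite "lborel :: (real^2) measure" "lborel \<Otimes>\<^sub>M lborel :: ((real^2) \<times> (real^2)) measure"
    by unfold_locales
  define H where "H w = (case w of (x, z) \<Rightarrow> f (z + x) * cnj (f x))" for w
  have [measurable]: "H \<in> borel_measurable (lborel \<Otimes>\<^sub>M lborel)" unfolding H_def by measurable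
  have H: "integrable (lborel \<Otimes>\<^sub>M lborel) H"
    using integrable_autocorrelation[OF f] by (simp add: H_def[abs_def])
  define k where "k p w = of_real (heat_kernel s p) * (H w * iexp (p \<bullet> snd w / hbar))" for p :: "real^2" and w
  have [measurable]: "(\<lambda>(p, w). k p w) \<in> borel_measurable (lborel \<Otimes>\<^sub>M (lborel \<Otimes>\<^sub>M lborel))"
    unfolding k_def by measurable
  have [measurable]: "k p \<in> borel_measurable (lborel \<Otimes>\<^sub>M lborel)" for p unfolding k_def by measurable
  \<comment> \<open>The modulus separates into a function of \<open>p\<close> and a function of
    \<open>w\<close>, which reduces integrability of \<open>k\<close> to that of the two
    factors.\<close>
  have normk: "norm (k p w) = heat_kernel s p * norm (H w)" for p w
    using s by (simp add: k_def norm_mult)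
  have intk: "integrable (lborel \<Otimes>\<^sub>M (lborel \<Otimes>\<^sub>M lborel)) (\<lambda>(p, w). k p w)"
  proof (rule P.Fubini_integrable)
    show "integrable lborel (\<lambda>p. LINT w|(lborel \<Otimes>\<^sub>M lborel). norm (case (p, w) of (p, w) \<Rightarrow> k p w))"
      using integral_iexp_heat_kernel(1)[OF s, where 'a="real^2"] by (simp add: normk)
    show "AE p in lborel. integrable (lborel \<Otimes>\<^sub>M lborel) (\<lambda>w. case (p, w) of (p, w) \<Rightarrow> k p w)"
    proof (intro AE_I2)
      fix p :: "real^2"
      have "integrable (lborel \<Otimes>\<^sub>M lborel) (\<lambda>w. heat_kernel s p *\<^sub>R H w)" using H by auto
      then have "integrable (lborel \<Otimes>\<^sub>M lborel) (k p)"
        by (rule Bochner_Integration.integrable_bound) (use s in \<open>auto simp: normk\<close>)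
      then show "integrable (lborel \<Otimes>\<^sub>M lborel) (\<lambda>w. case (p, w) of (p, w) \<Rightarrow> k p w)" by simp
    qed
  qed measurable
  have k_eq: "(LINT w|(lborel \<Otimes>\<^sub>M lborel). k p w) = of_real (heat_kernel s p * (norm (fourier_integral hbar f p))\<^sup>2)" for p
  proof -
    have "(LINT w|(lborel \<Otimes>\<^sub>M lborel). k p w)
        = of_real (heat_kernel s p) * (LINT w|(lborel \<Otimes>\<^sub>M lborel). H w * iexp (p \<bullet> snd w / hbar))"
      unfolding k_def by (rule integral_mult_right_zero)
    also have "(LINT w|(lborel \<Otimes>\<^sub>M lborel). H w * iexp (p \<bullet> snd w / hbar)) = of_real ((norm (fourier_integral hbar f p))\<^sup>2)"
      unfolding norm_fourier_integral_power2_eq[OF f]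
      by (intro Bochner_Integration.integral_cong refl) (auto simp: H_def)
    finally show ?thesis by (simp only: of_real_mult)
  qed
  have "of_real (LINT p|lborel. heat_kernel s p * (norm (fourier_integral hbar f p))\<^sup>2)
      = (LINT p|lborel. (LINT w|(lborel \<Otimes>\<^sub>M lborel). k p w))"
    unfolding k_eq by (rule integral_complex_of_real[symmetric])
  also have "\<dots> = (LINT w|(lborel \<Otimes>\<^sub>M lborel). (LINT p|lborel. k p w))"
    by (rule P.Fubini_integral[symmetric]) (rule intk)
  also have "\<dots> = (LINT w|(lborel \<Otimes>\<^sub>M lborel). H w * of_real (exp (- s * (norm (snd w) / hbar)\<^sup>2 / 2)))"
  proof (intro Bochner_Integration.integral_cong refl)
    fix w :: "(real^2) \<times> (real^2)"
    have "k p w = H w * (of_real (heat_kernel s p) * iexp (p \<bullet> (snd w /\<^sub>R hbar)))" for p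
      by (simp add: k_def divide_inverse_commute)
    then have "(LINT p|lborel. k p w) = (LINT p|lborel. H w * (of_real (heat_kernel s p) * iexp (p \<bullet> (snd w /\<^sub>R hbar))))"
      by simp
    also have "\<dots> = H w * (LINT p|lborel. of_real (heat_kernel s p) * iexp (p \<bullet> (snd w /\<^sub>R hbar)))"
      by (rule integral_mult_right_zero)
    also have "(LINT p|lborel. of_real (heat_kernel s p) * iexp (p \<bullet> (snd w /\<^sub>R hbar))) = of_real (exp (- s * (norm (snd w /\<^sub>R hbar))\<^sup>2 / 2))"
      by (rule integral_iexp_heat_kernel(2)[OF s])
    also have "norm (snd w /\<^sub>R hbar) = norm (snd w) / hbar"
      using h by (simp add: divide_inverse_commute)
    finally show "(LINT p|lborel. k p w) = H w * of_real (exp (- s * (norm (snd w) / hbar)\<^sup>2 / 2))" .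
  qed
  also have "\<dots> = (LINT (x, z)|(lborel \<Otimes>\<^sub>M lborel). f (z + x) * cnj (f x) * of_real (exp (- s * (norm z / hbar)\<^sup>2 / 2)))"
    by (intro Bochner_Integration.integral_cong refl) (auto simp: H_def)
  finally show ?thesis .
qed

text \<open>Expand the square. Each of the two square terms integrates to the squared norm, because
  the kernel has mass 1 and translations preserve the norm; the cross term is the autocorrelation
  weighted by the kernel.\<close>

lemma heat_deviation_eq:
  fixes f :: "'a::euclidean_space \<Rightarrow> complex"
  assumes [measurable]: "f \<in> borel_measurable borel" and int: "integrable lborel (\<lambda>x. (norm (f x))\<^sup>2)"
    and f: "integrable lborel f" and t: "t > 0"
  shows "heat_deviation t f = ennreal (2 * (LINT x|lborel. (norm (f x))\<^sup>2)
    - 2 * Re (LINT (x, z)|(lborel \<Otimes>\<^sub>M lborel). f (z + x) * cnj (f x) * of_real (heat_kernel t z)))"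
proof -
  let ?M = "lborel \<Otimes>\<^sub>M lborel :: ('a \<times> 'a) measure"
  define N where "N = (LINT x|lborel. (norm (f x))\<^sup>2)"
  have N: "(\<integral>\<^sup>+x. ennreal ((norm (f x))\<^sup>2) \<partial>lborel) = ennreal N" "N \<ge> 0"
    using int by (auto simp: N_def nn_integral_eq_integral)
  have tr: "(\<integral>\<^sup>+x. ennreal ((norm (f (z + x)))\<^sup>2) \<partial>lborel) = ennreal N" for z
    using nn_integral_translate[of "\<lambda>x. ennreal ((norm (f x))\<^sup>2)" z] N by simp
  let ?A = "\<lambda>(x, z). heat_kernel t z * (norm (f (z + x)))\<^sup>2"
  let ?B = "\<lambda>(x, z::'a). heat_kernel t z * (norm (f x))\<^sup>2"
  let ?C = "\<lambda>(x, z). f (z + x) * cnj (f x) * of_real (heat_kernel t z)"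
  have nnA: "(\<integral>\<^sup>+w. ennreal (?A w) \<partial>?M) = ennreal N"
  proof -
    have "(\<integral>\<^sup>+w. ennreal (?A w) \<partial>?M) = (\<integral>\<^sup>+z. (\<integral>\<^sup>+x. ennreal (heat_kernel t z * (norm (f (z + x)))\<^sup>2) \<partial>lborel) \<partial>lborel)"
      by (subst lborel_pair.nn_integral_snd[symmetric]) auto
    also have "\<dots> = (\<integral>\<^sup>+(z::'a). ennreal (heat_kernel t z) * ennreal N \<partial>lborel)"
      using t by (simp add: ennreal_mult nn_integral_cmult tr)
    also have "\<dots> = ennreal N" using t by (simp add: nn_integral_multc nn_integral_heat_kernel)
    finally show ?thesis .
  qed
  have nnB: "(\<integral>\<^sup>+w. ennreal (?B w) \<partial>?M) = ennreal N"
  proof -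
    have "(\<integral>\<^sup>+w. ennreal (?B w) \<partial>?M) = (\<integral>\<^sup>+(z::'a). (\<integral>\<^sup>+x. ennreal (heat_kernel t z * (norm (f x))\<^sup>2) \<partial>lborel) \<partial>lborel)"
      by (subst lborel_pair.nn_integral_snd[symmetric]) auto
    also have "\<dots> = (\<integral>\<^sup>+(z::'a). ennreal (heat_kernel t z) * ennreal N \<partial>lborel)"
      using t by (simp add: ennreal_mult nn_integral_cmult N)
    also have "\<dots> = ennreal N" using t by (simp add: nn_integral_multc nn_integral_heat_kernel)
    finally show ?thesis .
  qed
  have A: "has_bochner_integral ?M ?A N"
    using t by (intro has_bochner_integral_nn_integral nnA N) auto
  have B: "has_bochner_integral ?M ?B N"
    using t by (intro has_bochner_integral_nn_integral nnB N) auto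
  have intC: "integrable ?M ?C"
  proof (rule Bochner_Integration.integrable_bound)
    show "integrable ?M (\<lambda>w. ?A w + ?B w)" using A B by (auto simp: has_bochner_integral_iff)
    have "norm (f (z + x)) * norm (f x) \<le> (norm (f (z + x)))\<^sup>2 + (norm (f x))\<^sup>2" for x z
      using zero_le_power2[of "norm (f (z + x)) - norm (f x)"] zero_le_power2[of "norm (f (z + x))"] zero_le_power2[of "norm (f x)"]
      unfolding power2_diff by linarith
    then show "AE w in ?M. norm (?C w) \<le> norm (?A w + ?B w)"
      using t by (intro AE_I2) (auto simp: norm_mult mult.commute[of "heat_kernel _ _"] intro!: mult_right_mono simp flip: distrib_right)
  qed measurable
  have eq: "heat_kernel t z * (norm (f (z + x) - f x))\<^sup>2 = ?A (x, z) + ?B (x, z) - 2 * Re (?C (x, z))" for x z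
    unfolding cmod_power2 by (simp add: power2_eq_square algebra_simps)
  have "heat_deviation t f = (\<integral>\<^sup>+w. ennreal (?A w + ?B w - 2 * Re (?C w)) \<partial>?M)"
    unfolding heat_deviation_def eq
    by (subst lborel.nn_integral_fst[symmetric]) auto
  also have "\<dots> = ennreal (LINT w|?M. ?A w + ?B w - 2 * Re (?C w))"
  proof (rule nn_integral_eq_integral)
    show "integrable ?M (\<lambda>w. ?A w + ?B w - 2 * Re (?C w))"
      using A B intC by (auto simp: has_bochner_integral_iff)
    have "0 \<le> ?A w + ?B w - 2 * Re (?C w)" for w
      using eq[of "snd w" "fst w", symmetric] t by simp
    then show "AE w in ?M. 0 \<le> ?A w + ?B w - 2 * Re (?C w)" by auto
  qed
  also have "(LINT w|?M. ?A w + ?B w - 2 * Re (?C w)) = N + N - 2 * Re (LINT w|?M. ?C w)"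
    using A B intC by (simp add: has_bochner_integral_iff)
  finally show ?thesis by (simp add: N_def)
qed

text \<open>A Gaussian-regularised Plancherel identity for the cross term of the expanded
  deviation.\<close>

lemma heat_deviation_eq_fourier_integral:
  assumes [measurable]: "f \<in> borel_measurable borel" and int: "integrable lborel (\<lambda>x. (norm (f x))\<^sup>2)"
    and f: "integrable lborel f" and h: "hbar > 0" and t: "t > 0"
  shows "integrable lborel (\<lambda>p. exp (- t * (norm p)\<^sup>2 / (2 * hbar\<^sup>2)) * (norm (fourier_integral hbar f p))\<^sup>2)" (is ?I)
   and "heat_deviation t f = ennreal (2 * (LINT x|lborel. (norm (f x))\<^sup>2)
    - 2 / (2 * pi * hbar)\<^sup>2 * (LINT p|lborel. exp (- t * (norm p)\<^sup>2 / (2 * hbar\<^sup>2)) * (norm (fourier_integral hbar f p))\<^sup>2))" (is ?E)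
proof -
  \<comment> \<open>With this time the kernel in p is proportional to the required Gaussian weight,
    and its transform is proportional to the kernel in z at time \<open>t\<close>.\<close>
  define s where "s = hbar\<^sup>2 / t"
  have s: "s > 0" using h t by (simp add: s_def)
  have k: "exp (- t * (norm p)\<^sup>2 / (2 * hbar\<^sup>2)) = 2 * pi * s * heat_kernel s p" for p :: "real^2"
    using h t s by (simp add: heat_kernel_def s_def)
  have k': "exp (- s * (norm z / hbar)\<^sup>2 / 2) = 2 * pi * t * heat_kernel t z" for z :: "real^2"
    using h t by (simp add: heat_kernel_def s_def power_divide)
  \<comment> \<open>The transform of an integrable function is bounded by its L1 norm, so a multiple
    of the kernel is an integrable majorant.\<close>
  have "integrable lborel (\<lambda>p. heat_kernel s p *\<^sub>R (LINT x|lborel. norm (f x))\<^sup>2)"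
    using integral_iexp_heat_kernel(1)[OF s] by (intro integrable_scaleR_left) auto
  then have "integrable lborel (\<lambda>p. heat_kernel s p * (norm (fourier_integral hbar f p))\<^sup>2)"
    by (rule Bochner_Integration.integrable_bound)
      (use s in \<open>auto simp: norm_mult intro!: mult_left_mono power_mono norm_fourier_integral_le[OF f]\<close>)
  then show ?I unfolding k mult.assoc by auto
  let ?Q = "LINT p|lborel. heat_kernel s p * (norm (fourier_integral hbar f p))\<^sup>2"
  let ?P = "LINT (x, z)|(lborel \<Otimes>\<^sub>M lborel). f (z + x) * cnj (f x) * of_real (heat_kernel t z)"
  have "complex_of_real ?Q = (LINT (x, z)|(lborel \<Otimes>\<^sub>M lborel). f (z + x) * cnj (f x) * of_real (2 * pi * t * heat_kernel t z))"
    unfolding integral_heat_kernel_norm_fourier_integral[OF f h s] k' ..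
  also have "\<dots> = (LINT w|(lborel \<Otimes>\<^sub>M lborel). of_real (2 * pi * t) * (case w of (x, z) \<Rightarrow> f (z + x) * cnj (f x) * of_real (heat_kernel t z)))"
    by (intro Bochner_Integration.integral_cong refl) (auto simp: ac_simps)
  also have "\<dots> = of_real (2 * pi * t) * ?P"
    by (rule integral_mult_right_zero)
  finally have "Re (of_real (2 * pi * t) * ?P) = ?Q"
    by (metis Re_complex_of_real)
  then have Q: "?Q = 2 * pi * t * Re ?P" by simp
  have "(LINT p|lborel. exp (- t * (norm p)\<^sup>2 / (2 * hbar\<^sup>2)) * (norm (fourier_integral hbar f p))\<^sup>2) = 2 * pi * s * ?Q"
    unfolding k mult.assoc by simp
  \<comment> \<open>The two planar normalisations multiply to (2 pi s) (2 pi t) = (2 pi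
    hbar)^2.\<close>
  also have "\<dots> = (2 * pi * hbar)\<^sup>2 * Re ?P"
    unfolding Q using t by (simp add: s_def power2_eq_square)
  finally have "2 / (2 * pi * hbar)\<^sup>2 * (LINT p|lborel. exp (- t * (norm p)\<^sup>2 / (2 * hbar\<^sup>2)) * (norm (fourier_integral hbar f p))\<^sup>2) = 2 * Re ?P"
    using h by simp
  then show ?E using heat_deviation_eq[OF assms(1,2,3) t] by simp
qed

section \<open>Bounding the deviation by the Fourier transform\<close>

lemma ennreal_plus_le: "ennreal (a + b) \<le> ennreal a + ennreal b"
  by (cases "a \<ge> 0"; cases "b \<ge> 0") (auto simp: ennreal_neg intro!: ennreal_leI simp flip: ennreal_plus)

text \<open>Subtracting the formulas at times s < t cancels the norm of f, and the deviation at s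
  disappears as s tends to 0. This gives the inequality in place of Plancherel's identity.\<close>

lemma heat_deviation_le_fourier_integral:
  assumes [measurable]: "f \<in> borel_measurable borel" and int: "integrable lborel (\<lambda>x. (norm (f x))\<^sup>2)"
    and f: "integrable lborel f" and h: "hbar > 0" and t: "t > 0"
  shows "heat_deviation t f \<le> ennreal (2 / (2 * pi * hbar)\<^sup>2) *
    (\<integral>\<^sup>+p. ennreal ((1 - exp (- t * (norm p)\<^sup>2 / (2 * hbar\<^sup>2))) * (norm (fourier_integral hbar f p))\<^sup>2) \<partial>lborel)" (is "_ \<le> ?B")
proof (rule tendsto_le[OF _ _ tendsto_const])
  show "((\<lambda>s. heat_deviation s f + ?B) \<longlongrightarrow> ?B) (at_right 0)"
    using tendsto_add[OF tendsto_heat_deviation[OF assms(1,2)] tendsto_const[of ?B]] by simp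
  have le: "heat_deviation t f \<le> heat_deviation s f + ?B" if s: "s \<in> {0<..<t}" for s
  proof -
    from s have s: "s > 0" "s < t" by auto
    define G where "G t p = exp (- t * (norm p)\<^sup>2 / (2 * hbar\<^sup>2)) * (norm (fourier_integral hbar f p))\<^sup>2" for t p
    let ?c = "2 / (2 * pi * hbar)\<^sup>2"
    let ?N = "LINT x|lborel. (norm (f x))\<^sup>2"
    note D = heat_deviation_eq_fourier_integral[OF assms(1-4), folded G_def]
    have intg: "integrable lborel (\<lambda>p. G s p - G t p)" using D(1)[OF s(1)] D(1)[OF t] by auto
    have "?c * (LINT p|lborel. G s p) - ?c * (LINT p|lborel. G t p) = ?c * (LINT p|lborel. G s p - G t p)"
      using D(1)[OF s(1)] D(1)[OF t] by (simp add: right_diff_distrib)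
    then have "2 * ?N - ?c * (LINT p|lborel. G t p) = (2 * ?N - ?c * (LINT p|lborel. G s p)) + ?c * (LINT p|lborel. G s p - G t p)"
      by linarith
    then have "heat_deviation t f = ennreal ((2 * ?N - ?c * (LINT p|lborel. G s p)) + ?c * (LINT p|lborel. G s p - G t p))"
      unfolding D(2)[OF t] by (rule arg_cong)
    \<comment> \<open>The sign of the first summand has not been established; subadditivity of
      \<open>ennreal\<close> holds for all reals.\<close>
    also have "\<dots> \<le> heat_deviation s f + ennreal (?c * (LINT p|lborel. G s p - G t p))"
      unfolding D(2)[OF s(1)] by (rule ennreal_plus_le)
    also have "ennreal (?c * (LINT p|lborel. G s p - G t p)) = ennreal ?c * ennreal (LINT p|lborel. G s p - G t p)"
      by (rule ennreal_mult') simp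
    also have "ennreal (LINT p|lborel. G s p - G t p) = (\<integral>\<^sup>+p. ennreal (G s p - G t p) \<partial>lborel)"
      using s by (intro nn_integral_eq_integral[symmetric] intg)
        (auto simp: G_def intro!: AE_I2 mult_right_mono divide_right_mono)
    \<comment> \<open>The Gaussian weight at time \<open>s\<close> is at most 1, which makes the
      bound independent of \<open>s\<close>.\<close>
    also have "\<dots> \<le> (\<integral>\<^sup>+p. ennreal ((1 - exp (- t * (norm p)\<^sup>2 / (2 * hbar\<^sup>2))) * (norm (fourier_integral hbar f p))\<^sup>2) \<partial>lborel)"
      unfolding G_def left_diff_distrib[symmetric]
      using s by (intro nn_integral_mono ennreal_leI mult_right_mono diff_right_mono) auto
    finally show ?thesis by (simp add: add_left_mono mult_left_mono)
  qed
  show "\<forall>\<^sub>F s in at_right 0. heat_deviation t f \<le> heat_deviation s f + ?B"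
    using eventually_at_right_real[OF t] by eventually_elim (rule le)
qed simp


text \<open>The left side is at most the minimum of u and 1. The square root turns a weight
  quadratic in |p| into one linear in |p|, the growth of the kinetic energy.\<close>

lemma one_minus_exp_le_sqrt:
  fixes u :: real
  assumes "u \<ge> 0"
  shows "1 - exp (- u) \<le> sqrt u"
proof (cases "u \<le> 1")
  case True
  have "1 - exp (- u) \<le> u" using exp_ge_add_one_self[of "- u"] by simp
  also have "\<dots> \<le> sqrt u" using assms True by (intro real_le_rsqrt power_le_one_iff[THEN iffD2]) (auto simp: power2_eq_square mult_left_le)
  finally show ?thesis .
next
  case False
  have "1 - exp (- u) \<le> 1" by simp
  also have "\<dots> \<le> sqrt u" using False by simp
  finally show ?thesis .
qed

text \<open>Fatou's lemma on the product space: at any two given points the truncation is eventually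
  inactive, so the integrands are eventually constant.\<close>

lemma heat_deviation_le_Liminf:
  fixes f :: "'a::euclidean_space \<Rightarrow> complex"
  assumes [measurable]: "f \<in> borel_measurable borel"
  shows "heat_deviation t f \<le> liminf (\<lambda>n. heat_deviation t (\<lambda>x. indicator (cball 0 (real n)) x * f x))"
proof -
  define g where "g n x = indicator (cball 0 (real n)) x * f x" for n x
  have [measurable]: "cball (0::'a) (real n) \<in> sets borel" for n by simp
  have [measurable]: "g n \<in> borel_measurable borel" for n unfolding g_def by measurable
  have g: "\<forall>\<^sub>F n in sequentially. g n x = f x" for x
    using eventually_ge_at_top[of "nat \<lceil>norm x\<rceil>"]
    by eventually_elim (auto simp: g_def indicator_def nat_le_iff ceiling_le_iff)
  let ?h = "\<lambda>f (x, z). ennreal (heat_kernel t z * (norm (f (z + x) - f x))\<^sup>2)"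
  have lim: "liminf (\<lambda>n. ?h (g n) w) = ?h f w" for w
  proof -
    have "\<forall>\<^sub>F n in sequentially. ?h (g n) w = ?h f w"
      using g[of "fst w"] g[of "snd w + fst w"] by eventually_elim (simp add: case_prod_beta)
    then have "(\<lambda>n. ?h (g n) w) \<longlonglongrightarrow> ?h f w" by (rule tendsto_eventually)
    then show ?thesis by (rule lim_imp_Liminf[OF sequentially_bot])
  qed
  have eq: "heat_deviation t k = (\<integral>\<^sup>+w. ?h k w \<partial>(lborel \<Otimes>\<^sub>M lborel))"
    if [measurable]: "k \<in> borel_measurable borel" for k :: "'a \<Rightarrow> complex"
    unfolding heat_deviation_def by (subst lborel.nn_integral_fst[symmetric]) auto
  have "heat_deviation t f = (\<integral>\<^sup>+w. liminf (\<lambda>n. ?h (g n) w) \<partial>(lborel \<Otimes>\<^sub>M lborel))"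
    unfolding lim by (rule eq) measurable
  also have "\<dots> \<le> liminf (\<lambda>n. \<integral>\<^sup>+w. ?h (g n) w \<partial>(lborel \<Otimes>\<^sub>M lborel))"
    by (rule nn_integral_liminf) measurable
  finally show ?thesis unfolding g_def[symmetric] by (simp add: eq)
qed

text \<open>The truncations of f are integrable and their transforms converge to g in L2 by the
  definition of the transform. The weight is at most 1, so replacing the transform by g costs only
  an error that tends to 0, and Fatou's lemma passes to f.\<close>

lemma heat_deviation_le_fourier_transform:
  assumes F: "has_fourier_transform hbar f g" and h: "hbar > 0" and t: "t > 0"
  shows "heat_deviation t f \<le> ennreal (4 * sqrt t / ((2 * pi * hbar)\<^sup>2 * hbar)) *
    (\<integral>\<^sup>+p. ennreal (norm p * (norm (g p))\<^sup>2) \<partial>lborel)"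
proof -
  have f[measurable]: "f \<in> borel_measurable borel" and f2: "integrable lborel (\<lambda>x. (norm (f x))\<^sup>2)"
    and [measurable]: "g \<in> borel_measurable borel"
    using F by (auto simp: has_fourier_transform_def square_integrable_def)
  define fn where "fn n x = indicator (cball 0 (real n)) x * f x" for n x
  have [measurable]: "cball (0::real^2) (real n) \<in> sets borel" for n by simp
  have [measurable]: "fn n \<in> borel_measurable borel" for n unfolding fn_def by measurable
  have fn2: "integrable lborel (\<lambda>x. (norm (fn n x))\<^sup>2)" for n
    by (rule Bochner_Integration.integrable_bound[OF f2]) (auto simp: fn_def indicator_def)
  have fn1: "integrable lborel (fn n)" for n
  proof (rule Bochner_Integration.integrable_bound)
    show "integrable lborel (\<lambda>x. indicator (cball 0 (real n)) x + (norm (f x))\<^sup>2)"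
      using f2 by (intro Bochner_Integration.integrable_add)
        (auto intro!: integrable_real_indicator emeasure_lborel_cball_finite)
    \<comment> \<open>On a ball, which has finite measure, square integrability implies
      integrability.\<close>
    have "r \<le> 1 + r\<^sup>2" if "r \<ge> 0" for r :: real
      using zero_le_power2[of "r - 1"] that unfolding power2_diff by simp
    then show "AE x in lborel. norm (fn n x) \<le> norm (indicator (cball 0 (real n)) x + (norm (f x))\<^sup>2)"
      by (auto simp: fn_def indicator_def)
  qed measurable
  define e where "e n = (\<integral>\<^sup>+p. ennreal ((norm (fourier_integral hbar (fn n) p - g p))\<^sup>2) \<partial>lborel)" for n
  have e: "e \<longlonglongrightarrow> 0"
    using F unfolding has_fourier_transform_def e_def fn_def by simp
  define w where "w p = 1 - exp (- t * (norm p)\<^sup>2 / (2 * hbar\<^sup>2))" for p :: "real^2"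
  have [measurable]: "w \<in> borel_measurable borel" unfolding w_def by measurable
  have w: "0 \<le> w p" "w p \<le> 1" for p using t by (auto simp: w_def)
  let ?c = "ennreal (2 / (2 * pi * hbar)\<^sup>2)"
  let ?G = "\<integral>\<^sup>+p. ennreal (w p * (norm (g p))\<^sup>2) \<partial>lborel"
  have bound: "heat_deviation t (fn n) \<le> ?c * (2 * ?G + 2 * e n)" for n
  proof -
    have "heat_deviation t (fn n) \<le> ?c * (\<integral>\<^sup>+p. ennreal (w p * (norm (fourier_integral hbar (fn n) p))\<^sup>2) \<partial>lborel)"
      unfolding w_def by (rule heat_deviation_le_fourier_integral[OF _ fn2 fn1 h t]) measurable
    also have "(\<integral>\<^sup>+p. ennreal (w p * (norm (fourier_integral hbar (fn n) p))\<^sup>2) \<partial>lborel)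
      \<le> (\<integral>\<^sup>+p. 2 * ennreal (w p * (norm (g p))\<^sup>2) + 2 * ennreal ((norm (fourier_integral hbar (fn n) p - g p))\<^sup>2) \<partial>lborel)"
    proof (intro nn_integral_mono)
      fix p
      let ?F = "fourier_integral hbar (fn n) p"
      have "(norm ?F)\<^sup>2 \<le> 2 * (norm (g p))\<^sup>2 + 2 * (norm (?F - g p))\<^sup>2"
        using norm_diff_power2_le[of "?F - g p" "- g p"] by simp
      then have "w p * (norm ?F)\<^sup>2 \<le> w p * (2 * (norm (g p))\<^sup>2 + 2 * (norm (?F - g p))\<^sup>2)"
        by (rule mult_left_mono[OF _ w(1)])
      also have "\<dots> \<le> 2 * (w p * (norm (g p))\<^sup>2) + 2 * (norm (?F - g p))\<^sup>2"
        using mult_right_mono[OF w(2)[of p], of "(norm (?F - g p))\<^sup>2"] by (simp add: distrib_left)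
      finally have "ennreal (w p * (norm ?F)\<^sup>2) \<le> ennreal (2 * (w p * (norm (g p))\<^sup>2) + 2 * (norm (?F - g p))\<^sup>2)"
        by (rule ennreal_leI)
      also have "\<dots> = 2 * ennreal (w p * (norm (g p))\<^sup>2) + 2 * ennreal ((norm (?F - g p))\<^sup>2)"
        using w(1)[of p] by (simp add: ennreal_mult')
      finally show "ennreal (w p * (norm ?F)\<^sup>2) \<le> 2 * ennreal (w p * (norm (g p))\<^sup>2) + 2 * ennreal ((norm (?F - g p))\<^sup>2)" .
    qed
    also have "\<dots> = 2 * ?G + 2 * e n"
      unfolding e_def by (simp add: nn_integral_add nn_integral_cmult)
    finally show ?thesis by (simp add: mult_left_mono)
  qed
  have "(\<lambda>n. ?c * (2 * ?G + 2 * e n)) \<longlonglongrightarrow> ?c * (2 * ?G + 2 * 0)"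
    by (intro ennreal_tendsto_cmult tendsto_add tendsto_const e) auto
  then have lim: "liminf (\<lambda>n. ?c * (2 * ?G + 2 * e n)) = ?c * (2 * ?G)"
    by (subst lim_imp_Liminf) auto
  have "heat_deviation t f \<le> liminf (\<lambda>n. heat_deviation t (fn n))"
    unfolding fn_def by (rule heat_deviation_le_Liminf[OF f])
  also have "\<dots> \<le> liminf (\<lambda>n. ?c * (2 * ?G + 2 * e n))"
    by (rule Liminf_mono) (auto intro: always_eventually bound)
  also have "\<dots> = ?c * (2 * ?G)" by (rule lim)
  also have "?G \<le> (\<integral>\<^sup>+p. ennreal (sqrt t / hbar) * ennreal (norm p * (norm (g p))\<^sup>2) \<partial>lborel)"
  proof (intro nn_integral_mono)
    fix p
    have "w p \<le> sqrt (t * (norm p)\<^sup>2 / (2 * hbar\<^sup>2))"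
      using one_minus_exp_le_sqrt[of "t * (norm p)\<^sup>2 / (2 * hbar\<^sup>2)"] t by (simp add: w_def)
    also have "\<dots> \<le> sqrt (t * (norm p)\<^sup>2 / hbar\<^sup>2)"
      using h t by (intro real_sqrt_le_mono) (simp add: field_simps)
    also have "\<dots> = sqrt t / hbar * norm p"
      using h by (simp add: real_sqrt_mult real_sqrt_divide)
    finally have "w p * (norm (g p))\<^sup>2 \<le> sqrt t / hbar * norm p * (norm (g p))\<^sup>2"
      by (rule mult_right_mono) simp
    then show "ennreal (w p * (norm (g p))\<^sup>2) \<le> ennreal (sqrt t / hbar) * ennreal (norm p * (norm (g p))\<^sup>2)"
      using h t by (subst ennreal_mult'[symmetric]) (auto intro!: ennreal_leI simp: mult.assoc)
  qed
  also have "\<dots> = ennreal (sqrt t / hbar) * (\<integral>\<^sup>+p. ennreal (norm p * (norm (g p))\<^sup>2) \<partial>lborel)"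
    by (rule nn_integral_cmult) measurable
  finally have "heat_deviation t f \<le> ?c * (2 * (ennreal (sqrt t / hbar) * (\<integral>\<^sup>+p. ennreal (norm p * (norm (g p))\<^sup>2) \<partial>lborel)))"
    by (simp add: mult_left_mono)
  also have "\<dots> = (?c * ennreal 2 * ennreal (sqrt t / hbar)) * (\<integral>\<^sup>+p. ennreal (norm p * (norm (g p))\<^sup>2) \<partial>lborel)"
    by (simp add: mult.assoc)
  also have "?c * ennreal 2 * ennreal (sqrt t / hbar) = ennreal (2 / (2 * pi * hbar)\<^sup>2 * 2 * (sqrt t / hbar))"
    using h t by (simp only: ennreal_mult'' zero_le_numeral divide_nonneg_pos real_sqrt_ge_zero less_imp_le)
  also have "2 / (2 * pi * hbar)\<^sup>2 * 2 * (sqrt t / hbar) = 4 * sqrt t / ((2 * pi * hbar)\<^sup>2 * hbar)"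
    by simp
  finally show ?thesis .
qed

section \<open>The potential energy\<close>

text \<open>Averaging |f(x)|^2 <= 2 |f(z + x)|^2 + 2 |f(z + x) - f(x)|^2 against the kernel, whose
  maximum is 1 / (2 pi t), bounds |f(x)|^2 by the squared norm over pi t plus the local deviation.
  The ball has area pi r^2; the deviation is integrated over the whole plane.\<close>

lemma nn_integral_ball_le_heat_deviation:
  fixes f :: "real^2 \<Rightarrow> complex"
  assumes [measurable]: "f \<in> borel_measurable borel" and t: "t > 0" and r: "r \<ge> 0"
  shows "(\<integral>\<^sup>+x\<in>ball 0 r. ennreal ((norm (f x))\<^sup>2) \<partial>lborel)
    \<le> ennreal (r\<^sup>2 / t) * (\<integral>\<^sup>+x. ennreal ((norm (f x))\<^sup>2) \<partial>lborel) + 2 * heat_deviation t f"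
proof -
  let ?N = "\<integral>\<^sup>+x. ennreal ((norm (f x))\<^sup>2) \<partial>lborel"
  define D where "D x = (\<integral>\<^sup>+z. ennreal (heat_kernel t z * (norm (f (z + x) - f x))\<^sup>2) \<partial>lborel)" for x
  have [measurable]: "D \<in> borel_measurable borel" unfolding D_def by measurable
  have [measurable]: "ball (0::real^2) r \<in> sets borel" by simp
  have tr: "(\<integral>\<^sup>+z. ennreal ((norm (f (z + x)))\<^sup>2) \<partial>lborel) = ?N" for x
    using nn_integral_translate[of "\<lambda>x. ennreal ((norm (f x))\<^sup>2)" x] by (simp add: add.commute)
  have pw: "ennreal ((norm (f x))\<^sup>2) \<le> ennreal (1 / (pi * t)) * ?N + 2 * D x" for x
  proof -
    have "ennreal ((norm (f x))\<^sup>2) = (\<integral>\<^sup>+(z::real^2). ennreal (heat_kernel t z) * ennreal ((norm (f x))\<^sup>2) \<partial>lborel)"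
      using t by (simp add: nn_integral_multc nn_integral_heat_kernel)
    also have "\<dots> \<le> (\<integral>\<^sup>+z. ennreal (1 / (pi * t)) * ennreal ((norm (f (z + x)))\<^sup>2) + 2 * ennreal (heat_kernel t z * (norm (f (z + x) - f x))\<^sup>2) \<partial>lborel)"
    proof (intro nn_integral_mono)
      fix z :: "real^2"
      have k: "heat_kernel t z \<le> 1 / (2 * pi * t)"
        using t by (simp add: heat_kernel_def divide_right_mono)
      have "heat_kernel t z * (norm (f x))\<^sup>2 \<le> heat_kernel t z * (2 * (norm (f (z + x)))\<^sup>2 + 2 * (norm (f (z + x) - f x))\<^sup>2)"
        using t norm_diff_power2_le[of "f (z + x)" "f (z + x) - f x"] by (intro mult_left_mono) auto
      also have "\<dots> \<le> 1 / (pi * t) * (norm (f (z + x)))\<^sup>2 + 2 * (heat_kernel t z * (norm (f (z + x) - f x))\<^sup>2)"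
        using mult_right_mono[OF k, of "2 * (norm (f (z + x)))\<^sup>2"] by (simp add: distrib_left)
      finally have "ennreal (heat_kernel t z * (norm (f x))\<^sup>2)
          \<le> ennreal (1 / (pi * t) * (norm (f (z + x)))\<^sup>2 + 2 * (heat_kernel t z * (norm (f (z + x) - f x))\<^sup>2))"
        by (rule ennreal_leI)
      then show "ennreal (heat_kernel t z) * ennreal ((norm (f x))\<^sup>2)
          \<le> ennreal (1 / (pi * t)) * ennreal ((norm (f (z + x)))\<^sup>2) + 2 * ennreal (heat_kernel t z * (norm (f (z + x) - f x))\<^sup>2)"
        using t by (subst (asm) ennreal_plus) (auto simp: ennreal_mult ennreal_mult' simp del: times_divide_eq_left)
    qed
    also have "\<dots> = ennreal (1 / (pi * t)) * ?N + 2 * D x"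
      unfolding D_def by (simp add: nn_integral_add nn_integral_cmult tr)
    finally show ?thesis .
  qed
  have "(\<integral>\<^sup>+x\<in>ball 0 r. ennreal ((norm (f x))\<^sup>2) \<partial>lborel)
    \<le> (\<integral>\<^sup>+x. ennreal (1 / (pi * t)) * ?N * indicator (ball 0 r) x + 2 * D x \<partial>lborel)"
    using pw by (intro nn_integral_mono) (auto simp: indicator_def)
  also have "\<dots> = ennreal (1 / (pi * t)) * ?N * emeasure lborel (ball (0::real^2) r) + 2 * heat_deviation t f"
    unfolding heat_deviation_def D_def[symmetric] by (simp add: nn_integral_add nn_integral_cmult)
  also have "emeasure lborel (ball (0::real^2) r) = ennreal (pi * r\<^sup>2)"
    using r by (simp add: emeasure_ball unit_ball_vol_2)
  also have "ennreal (1 / (pi * t)) * ?N * ennreal (pi * r\<^sup>2) = ennreal (1 / (pi * t) * (pi * r\<^sup>2)) * ?N"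
    using t by (subst ennreal_mult) (auto simp: ac_simps)
  also have "1 / (pi * t) * (pi * r\<^sup>2) = r\<^sup>2 / t" by simp
  finally show ?thesis .
qed

text \<open>Outside the largest ball the constant suffices. A nonzero x inside lies between two
  consecutive radii, where 1 / sqrt |x| is at most 8 / s^3 with s^6 the larger radius, so a single
  term of the series already dominates.\<close>

lemma inverse_sqrt_norm_le_suminf_ball:
  fixes x :: "'a::real_normed_vector"
  assumes \<sigma>: "\<sigma> > 0"
  shows "ennreal (1 / sqrt (norm x)) \<le> ennreal (1 / \<sigma>^3)
    + (\<Sum>k. ennreal (8 / (\<sigma> / 2^k)^3) * indicator (ball 0 ((\<sigma> / 2^k)^6)) x)"
proof -
  define s where "s k = \<sigma> / 2^k" for k :: nat
  have s: "s k > 0" "s (Suc k) = s k / 2" for k using \<sigma> by (auto simp: s_def)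
  have sqrt6: "sqrt (s k ^ 6) = s k ^ 3" for k
    using s(1)[of k] by (intro real_sqrt_unique) (auto simp flip: power_mult)
  consider "x = 0" | "s 0 ^ 6 \<le> norm x" | "x \<noteq> 0" "norm x < s 0 ^ 6" by fastforce
  then show ?thesis
  proof cases
    \<comment> \<open>Here division by zero makes the left side 0.\<close>
    case 1
    then show ?thesis by simp
  next
    case 2
    then have "s 0 ^ 3 \<le> sqrt (norm x)" using sqrt6[of 0] by (metis real_sqrt_le_mono)
    then have "1 / sqrt (norm x) \<le> 1 / \<sigma>^3"
      using \<sigma> by (intro divide_left_mono mult_pos_pos) (auto simp: s_def intro: less_le_trans[of 0 "\<sigma>^3"])
    then show ?thesis by (intro add_increasing2 ennreal_leI) auto
  next
    case 3
    have "(\<lambda>k. \<sigma> * (1/2)^k) \<longlonglongrightarrow> \<sigma> * 0" by (intro tendsto_intros) auto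
    then have "(\<lambda>k. (\<sigma> * (1/2)^k)^6) \<longlonglongrightarrow> (\<sigma> * 0)^6" by (intro tendsto_power)
    then have "(\<lambda>k. s k ^ 6) \<longlonglongrightarrow> 0" by (simp add: s_def power_one_over)
    then have "\<forall>\<^sub>F k in sequentially. s k ^ 6 < norm x"
      using 3 by (auto simp: order_tendsto_iff)
    then obtain m where m: "s m ^ 6 \<le> norm x"
      by (meson eventually_happens less_imp_le trivial_limit_sequentially)
    \<comment> \<open>The first radius not exceeding |x|. Its index is positive because x lies in
      the largest ball, so its predecessor \<open>j\<close> selects the dominating term.\<close>
    define k where "k = (LEAST m. s m ^ 6 \<le> norm x)"
    have k: "s k ^ 6 \<le> norm x" unfolding k_def by (rule LeastI[of "\<lambda>m. s m ^ 6 \<le> norm x", OF m])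
    with 3 obtain j where j: "k = Suc j" by (cases k) auto
    have "norm x < s j ^ 6"
      using not_less_Least[of j "\<lambda>m. s m ^ 6 \<le> norm x"] j unfolding k_def by simp
    have "s k ^ 3 \<le> sqrt (norm x)" using sqrt6[of k] k by (metis real_sqrt_le_mono)
    then have "1 / sqrt (norm x) \<le> 1 / s k ^ 3"
      using 3 s(1)[of k] by (intro divide_left_mono) auto
    also have "\<dots> = 8 / s j ^ 3" by (simp add: j s(2) power_divide)
    finally have "ennreal (1 / sqrt (norm x)) \<le> ennreal (8 / s j ^ 3) * indicator (ball 0 (s j ^ 6)) x"
      using \<open>norm x < s j ^ 6\<close> by (simp add: ennreal_leI)
    also have "\<dots> \<le> (\<Sum>k. ennreal (8 / s k ^ 3) * indicator (ball 0 (s k ^ 6)) x)"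
    proof -
      have "h j \<le> (\<Sum>k. h k)" for h :: "nat \<Rightarrow> ennreal"
        using sum_le_suminf[of h "{j}"] by simp
      then show ?thesis .
    qed
    finally show ?thesis unfolding s_def by (simp add: add_increasing)
  qed
qed

text \<open>
  The radii \<open>s\<^sub>k\<^sup>6\<close> and times \<open>s\<^sub>k\<^sup>8\<close> with \<open>s\<^sub>k = \<sigma> / 2\<^sup>k\<close> make both terms of the ball
  estimate of order \<open>s\<^sub>k\<^sup>4\<close>, while the potential is of order \<open>s\<^sub>k\<^sup>-\<^sup>3\<close> on the shells.
\<close>

lemma nn_integral_inverse_sqrt_norm_le:
  fixes f :: "real^2 \<Rightarrow> complex"
  assumes [measurable]: "f \<in> borel_measurable borel" and \<sigma>: "\<sigma> > 0" and N: "N \<ge> 0" and K: "K \<ge> 0"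
    and fN: "(\<integral>\<^sup>+x. ennreal ((norm (f x))\<^sup>2) \<partial>lborel) \<le> ennreal N"
    and fK: "\<And>t. t > 0 \<Longrightarrow> heat_deviation t f \<le> ennreal (sqrt t * K)"
  shows "(\<integral>\<^sup>+x. ennreal (1 / sqrt (norm x) * (norm (f x))\<^sup>2) \<partial>lborel)
    \<le> ennreal (N / \<sigma>^3 + 16 * \<sigma> * (N + 2 * K))"
proof -
  define s where "s k = \<sigma> / 2^k" for k :: nat
  have s: "s k > 0" for k using \<sigma> by (auto simp: s_def)
  \<comment> \<open>Chosen so that the ball estimate gives 8 / s^3 * s^4 * (N + 2 K) = c s for s =
    \<open>s k\<close>; these bounds form a geometric series, and the \<open>s k\<close> sum to 2
    \<sigma>.\<close>
  define c where "c = 8 * (N + 2 * K)"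
  have c: "c \<ge> 0" using N K by (simp add: c_def)
  have [measurable]: "ball (0::real^2) r \<in> sets borel" for r by simp
  have shell: "ennreal (8 / s k ^ 3) * (\<integral>\<^sup>+x\<in>ball 0 (s k ^ 6). ennreal ((norm (f x))\<^sup>2) \<partial>lborel) \<le> ennreal (c * s k)" for k
  proof -
    have "(\<integral>\<^sup>+x\<in>ball 0 (s k ^ 6). ennreal ((norm (f x))\<^sup>2) \<partial>lborel)
        \<le> ennreal ((s k ^ 6)\<^sup>2 / s k ^ 8) * (\<integral>\<^sup>+x. ennreal ((norm (f x))\<^sup>2) \<partial>lborel) + 2 * heat_deviation (s k ^ 8) f"
      using s[of k] by (intro nn_integral_ball_le_heat_deviation) auto
    also have "\<dots> \<le> ennreal ((s k ^ 6)\<^sup>2 / s k ^ 8) * ennreal N + 2 * ennreal (sqrt (s k ^ 8) * K)"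
      using s[of k] by (intro add_mono mult_left_mono fN fK) auto
    also have "\<dots> = ennreal ((s k ^ 6)\<^sup>2 / s k ^ 8 * N + 2 * (sqrt (s k ^ 8) * K))"
    proof -
      have "ennreal a * ennreal b + 2 * ennreal e = ennreal (a * b + 2 * e)" if "a \<ge> 0" "b \<ge> 0" "e \<ge> 0" for a b e
        using that by (simp add: ennreal_mult)
      then show ?thesis using N K s[of k] by (simp del: power_divide)
    qed
    also have "sqrt (s k ^ 8) = s k ^ 4"
      using s[of k] by (intro real_sqrt_unique) (auto simp flip: power_mult)
    also have "(s k ^ 6)\<^sup>2 = s k ^ 4 * s k ^ 8"
      by (simp flip: power_mult power_add)
    also have "s k ^ 4 * s k ^ 8 / s k ^ 8 = s k ^ 4"
      using s[of k] by (intro nonzero_mult_div_cancel_right) simp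
    also have "s k ^ 4 * N + 2 * (s k ^ 4 * K) = s k ^ 4 * (N + 2 * K)"
      by (simp add: algebra_simps)
    finally have "ennreal (8 / s k ^ 3) * (\<integral>\<^sup>+x\<in>ball 0 (s k ^ 6). ennreal ((norm (f x))\<^sup>2) \<partial>lborel)
        \<le> ennreal (8 / s k ^ 3) * ennreal (s k ^ 4 * (N + 2 * K))"
      by (rule mult_left_mono) simp
    also have "\<dots> = ennreal (8 / s k ^ 3 * (s k ^ 4 * (N + 2 * K)))"
      using s[of k] by (intro ennreal_mult'[symmetric]) auto
    also have "8 / s k ^ 3 * (s k ^ 4 * (N + 2 * K)) = c * s k"
      using s[of k] by (simp add: c_def power_numeral_reduce)
    finally show ?thesis .
  qed
  have "(\<integral>\<^sup>+x. ennreal (1 / sqrt (norm x) * (norm (f x))\<^sup>2) \<partial>lborel)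
    \<le> (\<integral>\<^sup>+x. ennreal (1 / \<sigma>^3) * ennreal ((norm (f x))\<^sup>2)
        + (\<Sum>k. ennreal (8 / s k ^ 3) * (ennreal ((norm (f x))\<^sup>2) * indicator (ball 0 (s k ^ 6)) x)) \<partial>lborel)"
  proof (intro nn_integral_mono)
    fix x :: "real^2"
    have "ennreal (1 / sqrt (norm x) * (norm (f x))\<^sup>2) = ennreal (1 / sqrt (norm x)) * ennreal ((norm (f x))\<^sup>2)"
      by (rule ennreal_mult') simp
    also have "\<dots> \<le> (ennreal (1 / \<sigma>^3) + (\<Sum>k. ennreal (8 / s k ^ 3) * indicator (ball 0 (s k ^ 6)) x)) * ennreal ((norm (f x))\<^sup>2)"
      unfolding s_def by (rule mult_right_mono[OF inverse_sqrt_norm_le_suminf_ball[OF \<sigma>]]) simp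
    also have "\<dots> = ennreal (1 / \<sigma>^3) * ennreal ((norm (f x))\<^sup>2)
        + (\<Sum>k. ennreal (8 / s k ^ 3) * (ennreal ((norm (f x))\<^sup>2) * indicator (ball 0 (s k ^ 6)) x))"
      unfolding distrib_right ennreal_suminf_multc[symmetric] by (simp only: ac_simps)
    finally show "ennreal (1 / sqrt (norm x) * (norm (f x))\<^sup>2) \<le> \<dots>" .
  qed
  also have "\<dots> = ennreal (1 / \<sigma>^3) * (\<integral>\<^sup>+x. ennreal ((norm (f x))\<^sup>2) \<partial>lborel)
      + (\<Sum>k. ennreal (8 / s k ^ 3) * (\<integral>\<^sup>+x\<in>ball 0 (s k ^ 6). ennreal ((norm (f x))\<^sup>2) \<partial>lborel))"
    by (simp add: nn_integral_add nn_integral_cmult nn_integral_suminf)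
  also have "\<dots> \<le> ennreal (1 / \<sigma>^3) * ennreal N + (\<Sum>k. ennreal (c * s k))"
    by (intro add_mono mult_left_mono fN suminf_le shell) auto
  also have "(\<Sum>k. ennreal (c * s k)) = ennreal (c * (2 * \<sigma>))"
  proof (rule suminf_ennreal_eq)
    show "0 \<le> c * s k" for k using c s[of k] by simp
    have "(\<lambda>k. c * \<sigma> * (1/2)^k) sums (c * \<sigma> * (1 / (1 - 1/2)))"
      by (intro sums_mult geometric_sums) simp
    then show "(\<lambda>k. c * s k) sums (c * (2 * \<sigma>))"
      by (simp add: s_def power_one_over ac_simps)
  qed
  also have "ennreal (1 / \<sigma>^3) * ennreal N + ennreal (c * (2 * \<sigma>)) = ennreal (1 / \<sigma>^3 * N + c * (2 * \<sigma>))"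
  proof -
    have "ennreal a * ennreal b + ennreal e = ennreal (a * b + e)" if "a \<ge> 0" "b \<ge> 0" "e \<ge> 0" for a b e
      using that by (simp add: ennreal_mult)
    then show ?thesis using N \<sigma> c by (simp del: times_divide_eq_left)
  qed
  also have "1 / \<sigma>^3 * N + c * (2 * \<sigma>) = N / \<sigma>^3 + 16 * \<sigma> * (N + 2 * K)"
    by (simp add: c_def)
  finally show ?thesis .
qed

section \<open>Bounds for the Bessel function\<close>

lemma bessel_K_0_nonneg: "bessel_K 0 r \<ge> 0"
  unfolding bessel_K_def set_lebesgue_integral_def by (intro Bochner_Integration.integral_nonneg) auto

lemma borel_measurable_bessel_K [measurable]: "bessel_K \<nu> \<in> borel_measurable borel"
  unfolding bessel_K_def set_lebesgue_integral_def cosh_def by measurable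

text \<open>With u = r exp t / 2, the bounds cosh t >= exp t / 2 and exp (- u) <= 1 / sqrt u
  dominate the integrand by sqrt (2 / r) exp (- t / 2), and exp (- t / 2) has integral 2 over the
  half-line.\<close>

lemma bessel_K_0_le:
  assumes r: "r > 0"
  shows "bessel_K 0 r \<le> 2 * sqrt 2 / sqrt r"
proof -
  let ?g = "\<lambda>t::real. indicator {0..} t * exp (- t / 2)"
  have "(\<integral>\<^sup>+t. ennreal (exp (- t / 2)) * indicator {0..} t \<partial>lborel) = ennreal (0 - (- 2 * exp (- 0 / 2)))"
  proof (rule nn_integral_FTC_atLeast)
    show "((\<lambda>t::real. - 2 * exp (- t / 2)) \<longlongrightarrow> 0) at_top" by real_asymp
    show "((\<lambda>t. - 2 * exp (- t / 2)) has_real_derivative exp (- t / 2)) (at t)" for t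
      by (auto intro!: derivative_eq_intros)
  qed auto
  then have "(\<integral>\<^sup>+t. ennreal (?g t) \<partial>lborel) = ennreal 2"
    by (simp add: mult.commute ennreal_mult' ennreal_indicator)
  then have g: "has_bochner_integral lborel ?g 2"
    by (intro has_bochner_integral_nn_integral) auto
  have "exp (- r * cosh t) \<le> sqrt 2 / sqrt r * exp (- t / 2)" for t
  proof -
    let ?u = "r * exp t / 2"
    have "0 \<le> sqrt ?u" "(sqrt ?u)\<^sup>2 = ?u" using r by auto
    then have "sqrt ?u \<le> 1 + ?u"
      using zero_le_power2[of "sqrt ?u - 1"] unfolding power2_diff one_power2 mult_1_right by linarith
    also have "\<dots> \<le> exp ?u" by (rule exp_ge_add_one_self)
    finally have "exp (- ?u) \<le> 1 / sqrt ?u"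
      using r by (simp add: exp_minus field_simps)
    moreover have "exp t / 2 \<le> cosh t" by (simp add: cosh_def)
    then have "exp (- r * cosh t) \<le> exp (- ?u)" using r by (simp add: mult_left_mono flip: times_divide_eq_right)
    moreover have "sqrt (exp t) = exp (t / 2)"
      by (intro real_sqrt_unique) (auto simp flip: exp_of_nat_mult)
    then have "1 / sqrt ?u = sqrt 2 / sqrt r * exp (- t / 2)"
      by (simp add: real_sqrt_divide real_sqrt_mult exp_minus field_simps)
    ultimately show ?thesis by linarith
  qed
  then have "bessel_K 0 r \<le> (LINT t|lborel. sqrt 2 / sqrt r * ?g t)"
    unfolding bessel_K_def set_lebesgue_integral_def using g r
    by (intro integral_mono') (auto simp: has_bochner_integral_iff indicator_def)
  also have "\<dots> = 2 * sqrt 2 / sqrt r"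
    using g by (simp add: has_bochner_integral_iff)
  finally show ?thesis .
qed

section \<open>Scaling and uniqueness of the Fourier transform\<close>

lemma nn_integral_scale:
  fixes F :: "'a::euclidean_space \<Rightarrow> ennreal"
  assumes [measurable]: "F \<in> borel_measurable borel" and h: "h > 0"
  shows "(\<integral>\<^sup>+p. F (p /\<^sub>R h) \<partial>lborel) = ennreal (h ^ DIM('a)) * (\<integral>\<^sup>+p. F p \<partial>lborel)"
  using h by (subst lborel_affine[of h 0]) (auto simp: nn_integral_density nn_integral_distr nn_integral_cmult)

text \<open>Connects the parameter 1 of the Sobolev space with the parameter of the kinetic form:
  the change of variables p / h multiplies the squared L2 errors by h^2, so convergence is
  preserved.\<close>

lemma has_fourier_transform_scale:
  assumes F: "has_fourier_transform 1 f g" and h: "h > 0"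
  shows "has_fourier_transform h f (\<lambda>p. g (p /\<^sub>R h))"
proof -
  have f[measurable]: "f \<in> borel_measurable borel" and [measurable]: "g \<in> borel_measurable borel"
    and g2: "integrable lborel (\<lambda>p. (norm (g p))\<^sup>2)"
    using F by (auto simp: has_fourier_transform_def square_integrable_def)
  have "(\<integral>\<^sup>+p. ennreal ((norm (g (p /\<^sub>R h)))\<^sup>2) \<partial>lborel) < \<infinity>"
    using g2 h nn_integral_scale[of "\<lambda>p. ennreal ((norm (g p))\<^sup>2)" h]
    by (auto simp: integrable_iff_bounded ennreal_mult_less_top)
  then have "integrable lborel (\<lambda>p. (norm (g (p /\<^sub>R h)))\<^sup>2)"
    by (simp add: integrable_iff_bounded)
  then have sq: "(\<lambda>p. g (p /\<^sub>R h)) \<in> square_integrable"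
    by (simp add: square_integrable_def)
  define fn where "fn n x = indicator (cball 0 (real n)) x * f x" for n x
  have [measurable]: "cball (0::real^2) (real n) \<in> sets borel" for n by simp
  have [measurable]: "fn n \<in> borel_measurable borel" for n unfolding fn_def by measurable
  have scale: "fourier_integral h (fn n) p = fourier_integral 1 (fn n) (p /\<^sub>R h)" for n p
    unfolding fourier_integral_def by (simp add: divide_inverse_commute)
  have "(\<integral>\<^sup>+p. ennreal ((norm (fourier_integral h (fn n) p - g (p /\<^sub>R h)))\<^sup>2) \<partial>lborel)
      = ennreal (h ^ DIM(real^2)) * (\<integral>\<^sup>+p. ennreal ((norm (fourier_integral 1 (fn n) p - g p))\<^sup>2) \<partial>lborel)" for n
    unfolding scale
    by (rule nn_integral_scale[of "\<lambda>p. ennreal ((norm (fourier_integral 1 (fn n) p - g p))\<^sup>2)", OF _ h]) measurable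
  moreover have "(\<lambda>n. \<integral>\<^sup>+p. ennreal ((norm (fourier_integral 1 (fn n) p - g p))\<^sup>2) \<partial>lborel) \<longlonglongrightarrow> 0"
    using F unfolding has_fourier_transform_def fn_def by blast
  then have "(\<lambda>n. ennreal (h ^ DIM(real^2)) * (\<integral>\<^sup>+p. ennreal ((norm (fourier_integral 1 (fn n) p - g p))\<^sup>2) \<partial>lborel))
      \<longlonglongrightarrow> ennreal (h ^ DIM(real^2)) * 0"
    by (intro ennreal_tendsto_cmult) auto
  ultimately show ?thesis
    using F sq unfolding has_fourier_transform_def fn_def by simp
qed

text \<open>Both functions are L2 limits of the same truncated transforms. Hence the transform
  picked by the choice operator agrees almost everywhere with any other.\<close>

lemma has_fourier_transform_AE_unique:
  assumes F: "has_fourier_transform h f g" and F': "has_fourier_transform h f g'"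
  shows "AE p in lborel. g p = g' p"
proof -
  have f[measurable]: "f \<in> borel_measurable borel" and [measurable]: "g \<in> borel_measurable borel" "g' \<in> borel_measurable borel"
    using F F' by (auto simp: has_fourier_transform_def square_integrable_def)
  define fn where "fn n x = indicator (cball 0 (real n)) x * f x" for n x
  have [measurable]: "cball (0::real^2) (real n) \<in> sets borel" for n by simp
  have [measurable]: "fn n \<in> borel_measurable borel" for n unfolding fn_def by measurable
  define e where "e g n = (\<integral>\<^sup>+p. ennreal ((norm (fourier_integral h (fn n) p - g p))\<^sup>2) \<partial>lborel)" for g n
  have e: "e g \<longlonglongrightarrow> 0" "e g' \<longlonglongrightarrow> 0"
    using F F' unfolding has_fourier_transform_def e_def fn_def by auto
  have bound: "(\<integral>\<^sup>+p. ennreal ((norm (g p - g' p))\<^sup>2) \<partial>lborel) \<le> 2 * e g n + 2 * e g' n" for n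
  proof -
    have "(\<integral>\<^sup>+p. ennreal ((norm (g p - g' p))\<^sup>2) \<partial>lborel)
      \<le> (\<integral>\<^sup>+p. 2 * ennreal ((norm (fourier_integral h (fn n) p - g p))\<^sup>2) + 2 * ennreal ((norm (fourier_integral h (fn n) p - g' p))\<^sup>2) \<partial>lborel)"
    proof (intro nn_integral_mono)
      fix p
      let ?F = "fourier_integral h (fn n) p"
      have "(norm (g p - g' p))\<^sup>2 \<le> 2 * (norm (?F - g' p))\<^sup>2 + 2 * (norm (?F - g p))\<^sup>2"
        using norm_diff_power2_le[of "?F - g' p" "?F - g p"] by simp
      then have "ennreal ((norm (g p - g' p))\<^sup>2) \<le> ennreal (2 * (norm (?F - g p))\<^sup>2 + 2 * (norm (?F - g' p))\<^sup>2)"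
        by (intro ennreal_leI) simp
      then show "ennreal ((norm (g p - g' p))\<^sup>2) \<le> 2 * ennreal ((norm (?F - g p))\<^sup>2) + 2 * ennreal ((norm (?F - g' p))\<^sup>2)"
        by (simp add: ennreal_mult')
    qed
    also have "\<dots> = 2 * e g n + 2 * e g' n"
      unfolding e_def by (simp add: nn_integral_add nn_integral_cmult)
    finally show ?thesis .
  qed
  have "(\<lambda>n. 2 * e g n + 2 * e g' n) \<longlonglongrightarrow> 2 * 0 + 2 * 0"
    by (intro tendsto_add ennreal_tendsto_cmult e) auto
  then have "(\<integral>\<^sup>+p. ennreal ((norm (g p - g' p))\<^sup>2) \<partial>lborel) \<le> 0"
    using bound by (intro tendsto_lowerbound[of "\<lambda>n. 2 * e g n + 2 * e g' n"]) auto
  then have "AE p in lborel. ennreal ((norm (g p - g' p))\<^sup>2) = 0"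
    by (subst (asm) le_zero_eq, subst (asm) nn_integral_0_iff_AE) auto
  then show ?thesis by auto
qed

section \<open>The kinetic energy on H^(1/2) and the resulting form bounds\<close>

lemma sqrt_affine_le:
  fixes a b r :: real
  assumes "a \<ge> 0" "b \<ge> 0"
  shows "sqrt (a\<^sup>2 * r\<^sup>2 + b\<^sup>2) \<le> (a + b) * sqrt (1 + r\<^sup>2)"
proof (rule real_le_lsqrt)
  show "a\<^sup>2 * r\<^sup>2 + b\<^sup>2 \<le> ((a + b) * sqrt (1 + r\<^sup>2))\<^sup>2"
    using assms by (simp add: power_mult_distrib power2_sum algebra_simps)
qed (use assms in auto)

text \<open>Rescaling the transform with parameter 1 yields a witness for the choice operator. The
  kinetic symbol is dominated by the Sobolev weight, and uniqueness almost everywhere moves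
  integrability to the chosen transform.\<close>

lemma sobolev_space_half:
  assumes f: "f \<in> sobolev_space (1/2)" and h: "h > 0" and c: "c > 0" and m: "m > 0"
  shows "has_fourier_transform h f (fourier_transform h f)" (is "has_fourier_transform h f ?G")
    and "integrable lborel (\<lambda>p. sqrt (c\<^sup>2 * (norm p)\<^sup>2 + m\<^sup>2 * c ^ 4) * (norm (fourier_transform h f p))\<^sup>2)"
proof -
  from f obtain g where g: "has_fourier_transform 1 f g"
    and int: "integrable lborel (\<lambda>p. (1 + (norm p)\<^sup>2) powr (1/2) * (norm (g p))\<^sup>2)"
    by (auto simp: sobolev_space_def)
  note gh = has_fourier_transform_scale[OF g h]
  then show G: "has_fourier_transform h f ?G"
    unfolding fourier_transform_def by (rule someI[of "has_fourier_transform h f"])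
  have [measurable]: "g \<in> borel_measurable borel" "?G \<in> borel_measurable borel"
    using g G by (auto simp: has_fourier_transform_def square_integrable_def)
  let ?k = "\<lambda>p::real^2. sqrt (c\<^sup>2 * (norm p)\<^sup>2 + m\<^sup>2 * c ^ 4)"
  \<comment> \<open>The kinetic symbol in the rescaled momentum, so that \<open>?k p\<close> is
    \<open>?j (p /\<^sub>R h)\<close>; its constants are written as squares for
    \<open>sqrt_affine_le\<close>.\<close>
  let ?j = "\<lambda>p::real^2. sqrt ((c * h)\<^sup>2 * (norm p)\<^sup>2 + (m * c\<^sup>2)\<^sup>2)"
  have "integrable lborel (\<lambda>p. (c * h + m * c\<^sup>2) * ((1 + (norm p)\<^sup>2) powr (1/2) * (norm (g p))\<^sup>2))"
    using int by simp
  then have "integrable lborel (\<lambda>p. ?j p * (norm (g p))\<^sup>2)"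
  proof (rule Bochner_Integration.integrable_bound)
    have "?j p * (norm (g p))\<^sup>2 \<le> (c * h + m * c\<^sup>2) * ((1 + (norm p)\<^sup>2) powr (1/2) * (norm (g p))\<^sup>2)" for p
      using sqrt_affine_le[of "c * h" "m * c\<^sup>2" "norm p"] c h m
      unfolding mult.assoc[symmetric] by (intro mult_right_mono) (auto simp: powr_half_sqrt)
    then show "AE p in lborel. norm (?j p * (norm (g p))\<^sup>2) \<le> norm ((c * h + m * c\<^sup>2) * ((1 + (norm p)\<^sup>2) powr (1/2) * (norm (g p))\<^sup>2))"
      using c h m by (intro AE_I2) (simp add: abs_mult)
  qed measurable
  moreover have "?k p = ?j (p /\<^sub>R h)" for p
    using h by (simp add: power_mult_distrib power_inverse flip: power_mult)
  moreover have "(\<integral>\<^sup>+p. ennreal (?j (p /\<^sub>R h) * (norm (g (p /\<^sub>R h)))\<^sup>2) \<partial>lborel)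
      = ennreal (h ^ DIM(real^2)) * (\<integral>\<^sup>+p. ennreal (?j p * (norm (g p))\<^sup>2) \<partial>lborel)"
    by (rule nn_integral_scale[of "\<lambda>p. ennreal (?j p * (norm (g p))\<^sup>2)", OF _ h]) measurable
  ultimately have "integrable lborel (\<lambda>p. ?k p * (norm (g (p /\<^sub>R h)))\<^sup>2)"
    by (auto simp: integrable_iff_bounded ennreal_mult_less_top abs_mult)
  moreover have "AE p in lborel. ?k p * (norm (g (p /\<^sub>R h)))\<^sup>2 = ?k p * (norm (?G p))\<^sup>2"
    using has_fourier_transform_AE_unique[OF gh G] by auto
  ultimately show "integrable lborel (\<lambda>p. ?k p * (norm (?G p))\<^sup>2)"
    by (subst (asm) integrable_cong_AE) auto
qed

text \<open>The weight |p| is at most the kinetic symbol divided by c.\<close>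

lemma heat_deviation_le_kinetic_form:
  assumes f: "f \<in> sobolev_space (1/2)" and h: "h > 0" and c: "c > 0" and m: "m > 0" and t: "t > 0"
  shows "heat_deviation t f \<le> ennreal (sqrt t * (4 / (h * c) * kinetic_form h c m f))"
proof -
  let ?G = "fourier_transform h f"
  let ?k = "\<lambda>p::real^2. sqrt (c\<^sup>2 * (norm p)\<^sup>2 + m\<^sup>2 * c ^ 4)"
  note G = sobolev_space_half[OF f h c m]
  have [measurable]: "?G \<in> borel_measurable borel"
    using G(1) by (auto simp: has_fourier_transform_def square_integrable_def)
  define I where "I = (LINT p|lborel. ?k p * (norm (?G p))\<^sup>2)"
  have I: "I \<ge> 0" unfolding I_def by (intro Bochner_Integration.integral_nonneg) auto
  have "(\<integral>\<^sup>+p. ennreal (norm p * (norm (?G p))\<^sup>2) \<partial>lborel) \<le> (\<integral>\<^sup>+p. ennreal (1 / c) * ennreal (?k p * (norm (?G p))\<^sup>2) \<partial>lborel)"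
  proof (intro nn_integral_mono)
    fix p :: "real^2"
    have "c * norm p \<le> ?k p" by (intro real_le_rsqrt) (simp add: power_mult_distrib)
    then have "norm p \<le> 1 / c * ?k p" using c by (simp add: field_simps)
    from mult_right_mono[OF this, of "(norm (?G p))\<^sup>2"]
    show "ennreal (norm p * (norm (?G p))\<^sup>2) \<le> ennreal (1 / c) * ennreal (?k p * (norm (?G p))\<^sup>2)"
      using c by (subst ennreal_mult'[symmetric]) (auto intro!: ennreal_leI simp: mult.assoc)
  qed
  also have "\<dots> = ennreal (1 / c) * (\<integral>\<^sup>+p. ennreal (?k p * (norm (?G p))\<^sup>2) \<partial>lborel)"
    by (rule nn_integral_cmult) measurable
  also have "(\<integral>\<^sup>+p. ennreal (?k p * (norm (?G p))\<^sup>2) \<partial>lborel) = ennreal I"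
    unfolding I_def by (intro nn_integral_eq_integral G(2)) auto
  finally have "(\<integral>\<^sup>+p. ennreal (norm p * (norm (?G p))\<^sup>2) \<partial>lborel) \<le> ennreal (1 / c) * ennreal I" .
  from mult_left_mono[OF this, of "ennreal (4 * sqrt t / ((2 * pi * h)\<^sup>2 * h))"] heat_deviation_le_fourier_transform[OF G(1) h t]
  have "heat_deviation t f \<le> ennreal (4 * sqrt t / ((2 * pi * h)\<^sup>2 * h)) * (ennreal (1 / c) * ennreal I)"
    by (meson order_trans zero_le)
  also have "\<dots> = ennreal (4 * sqrt t / ((2 * pi * h)\<^sup>2 * h) * (1 / c * I))"
  proof -
    have "ennreal x * (ennreal y * ennreal z) = ennreal (x * (y * z))" if "x \<ge> 0" "y \<ge> 0" "z \<ge> 0" for x y z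
      using that by (simp add: ennreal_mult)
    then show ?thesis using h c t I by simp
  qed
  also have "4 * sqrt t / ((2 * pi * h)\<^sup>2 * h) * (1 / c * I) = sqrt t * (4 / (h * c) * kinetic_form h c m f)"
    unfolding kinetic_form_def I_def[symmetric] by (simp add: field_simps)
  finally show ?thesis .
qed

text \<open>Combines the Bessel bound with the weighted estimate for 1 / sqrt |x|, taking K = 4 / (h
  c) times the kinetic energy. Small \<sigma> makes the kinetic coefficient small at the expense of
  the norm term.\<close>

lemma potential_form_le:
  assumes f: "f \<in> sobolev_space (1/2)" and h: "h > 0" and c: "c > 0" and m: "m > 0" and b: "\<beta> > 0" and \<sigma>: "\<sigma> > 0"
  shows "integrable lborel (\<lambda>x. bessel_K 0 (\<beta> * norm x) * (norm (f x))\<^sup>2)"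
    and "potential_form \<beta> f \<le> 2 * sqrt 2 / sqrt \<beta> *
      ((L2_norm f)\<^sup>2 / \<sigma>^3 + 16 * \<sigma> * ((L2_norm f)\<^sup>2 + 8 / (h * c) * kinetic_form h c m f))" (is "_ \<le> ?A * ?R")
proof -
  have [measurable]: "f \<in> borel_measurable borel" and f2: "integrable lborel (\<lambda>x. (norm (f x))\<^sup>2)"
    using f by (auto simp: sobolev_space_def square_integrable_def)
  let ?V = "\<lambda>x. bessel_K 0 (\<beta> * norm x) * (norm (f x))\<^sup>2"
  have K: "kinetic_form h c m f \<ge> 0"
    unfolding kinetic_form_def by (intro mult_nonneg_nonneg Bochner_Integration.integral_nonneg) auto
  have N: "(L2_norm f)\<^sup>2 = (LINT x|lborel. (norm (f x))\<^sup>2)"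
    unfolding L2_norm_def by (intro real_sqrt_pow2 Bochner_Integration.integral_nonneg) auto
  have "(\<integral>\<^sup>+x. ennreal ((norm (f x))\<^sup>2) \<partial>lborel) \<le> ennreal ((L2_norm f)\<^sup>2)"
    unfolding N using f2 by (subst nn_integral_eq_integral) auto
  then have "(\<integral>\<^sup>+x. ennreal (1 / sqrt (norm x) * (norm (f x))\<^sup>2) \<partial>lborel)
      \<le> ennreal ((L2_norm f)\<^sup>2 / \<sigma>^3 + 16 * \<sigma> * ((L2_norm f)\<^sup>2 + 2 * (4 / (h * c) * kinetic_form h c m f)))"
    using K h c \<sigma> by (intro nn_integral_inverse_sqrt_norm_le heat_deviation_le_kinetic_form[OF f h c m]) auto
  also have "\<dots> = ennreal ?R" by simp
  finally have inv: "(\<integral>\<^sup>+x. ennreal (1 / sqrt (norm x) * (norm (f x))\<^sup>2) \<partial>lborel) \<le> ennreal ?R" .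
  \<comment> \<open>The Bessel bound requires a positive argument, so the origin is removed as a
    null set.\<close>
  have "AE x in lborel. ?V x \<le> ?A * (1 / sqrt (norm x) * (norm (f x))\<^sup>2)"
    using AE_lborel_singleton[of "0::real^2"]
  proof eventually_elim
    case (elim x)
    then have "bessel_K 0 (\<beta> * norm x) \<le> ?A * (1 / sqrt (norm x))"
      using bessel_K_0_le[of "\<beta> * norm x"] b by (simp add: real_sqrt_mult)
    from mult_right_mono[OF this, of "(norm (f x))\<^sup>2"] show ?case by (simp only: mult.assoc zero_le_power2)
  qed
  then have "(\<integral>\<^sup>+x. ennreal (?V x) \<partial>lborel) \<le> (\<integral>\<^sup>+x. ennreal ?A * ennreal (1 / sqrt (norm x) * (norm (f x))\<^sup>2) \<partial>lborel)"
  proof (intro nn_integral_mono_AE, elim eventually_mono)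
    fix x assume "?V x \<le> ?A * (1 / sqrt (norm x) * (norm (f x))\<^sup>2)"
    then have "ennreal (?V x) \<le> ennreal (?A * (1 / sqrt (norm x) * (norm (f x))\<^sup>2))"
      by (rule ennreal_leI)
    also have "\<dots> = ennreal ?A * ennreal (1 / sqrt (norm x) * (norm (f x))\<^sup>2)"
      using b by (intro ennreal_mult') auto
    finally show "ennreal (?V x) \<le> ennreal ?A * ennreal (1 / sqrt (norm x) * (norm (f x))\<^sup>2)" .
  qed
  also have "\<dots> = ennreal ?A * (\<integral>\<^sup>+x. ennreal (1 / sqrt (norm x) * (norm (f x))\<^sup>2) \<partial>lborel)"
    by (rule nn_integral_cmult) measurable
  also have "\<dots> \<le> ennreal ?A * ennreal ?R"
    by (rule mult_left_mono[OF inv]) simp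
  also have "\<dots> = ennreal (?A * ?R)" using b by (intro ennreal_mult'[symmetric]) auto
  finally have le: "(\<integral>\<^sup>+x. ennreal (?V x) \<partial>lborel) \<le> ennreal (?A * ?R)" .
  have V: "0 \<le> ?V x" for x by (simp add: bessel_K_0_nonneg)
  show int: "integrable lborel ?V"
    using le by (intro integrableI_nonneg) (auto simp: V top_unique less_top intro: le_less_trans)
  have "ennreal (potential_form \<beta> f) \<le> ennreal (?A * ?R)"
    using le unfolding potential_form_def by (subst nn_integral_eq_integral[OF int, symmetric]) (auto simp: V)
  moreover have "0 \<le> ?A * ?R"
    using K h c \<sigma> b by (intro mult_nonneg_nonneg add_nonneg_nonneg) auto
  ultimately show "potential_form \<beta> f \<le> ?A * ?R"
    by (simp only: ennreal_le_iff)
qed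

text \<open>The integrability clause ensures that the potential form is a genuine integral and not
  the value 0 assigned by convention to a divergent one.\<close>

theorem mainTheorem4:
  fixes hbar c m \<beta> \<gamma> :: real
  assumes "hbar > 0" and "c > 0" and "m > 0" and "\<beta> > 0" and "\<gamma> \<ge> 0"
  shows "\<exists>b::real. \<forall>\<psi> \<in> sobolev_space (1/2).
           integrable lborel (\<lambda>x. bessel_K 0 (\<beta> * norm x) * (norm (\<psi> x))\<^sup>2) \<and>
           B_FW_form hbar c m \<beta> \<gamma> \<psi> \<ge> - b * (L2_norm \<psi>)\<^sup>2"
proof -
  define A where "A = \<gamma> * (2 * sqrt 2 / sqrt \<beta>)"
  have A: "A \<ge> 0" using assms by (simp add: A_def)
  \<comment> \<open>Brings the kinetic coefficient 128 A \<sigma> / (hbar c) of the potential term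
    below 1; \<open>A + 1\<close> keeps the denominator positive when \<gamma> = 0.\<close>
  define \<sigma> where "\<sigma> = hbar * c / (128 * (A + 1))"
  have \<sigma>: "\<sigma> > 0" using assms A by (simp add: \<sigma>_def)
  have "A * 128 * \<sigma> + 128 * \<sigma> = 128 * (A + 1) * \<sigma>" by (simp add: algebra_simps)
  also have "\<dots> = hbar * c" using A by (simp add: \<sigma>_def)
  finally have small: "A * 128 * \<sigma> / (hbar * c) \<le> 1"
    using assms(1,2) \<sigma> by simp
  show ?thesis
  proof (intro exI[of _ "A * (1 / \<sigma>^3 + 16 * \<sigma>)"] ballI conjI)
    fix \<psi> assume \<psi>: "\<psi> \<in> sobolev_space (1/2)"
    note P = potential_form_le[OF \<psi> assms(1-4) \<sigma>]
    show "integrable lborel (\<lambda>x. bessel_K 0 (\<beta> * norm x) * (norm (\<psi> x))\<^sup>2)" by (rule P)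
    let ?K = "kinetic_form hbar c m \<psi>" and ?N = "(L2_norm \<psi>)\<^sup>2"
    have K: "?K \<ge> 0"
      unfolding kinetic_form_def by (intro mult_nonneg_nonneg Bochner_Integration.integral_nonneg) auto
    have "\<gamma> * potential_form \<beta> \<psi> \<le> \<gamma> * (2 * sqrt 2 / sqrt \<beta> * (?N / \<sigma>^3 + 16 * \<sigma> * (?N + 8 / (hbar * c) * ?K)))"
      using P(2) assms(5) by (rule mult_left_mono)
    also have "\<dots> = A * (1 / \<sigma>^3 + 16 * \<sigma>) * ?N + A * 128 * \<sigma> / (hbar * c) * ?K"
      unfolding A_def by (simp add: algebra_simps)
    also have "\<dots> \<le> A * (1 / \<sigma>^3 + 16 * \<sigma>) * ?N + ?K"
      using mult_right_mono[OF small K] by simp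
    finally show "B_FW_form hbar c m \<beta> \<gamma> \<psi> \<ge> - (A * (1 / \<sigma>^3 + 16 * \<sigma>)) * ?N"
      unfolding B_FW_form_def by simp
  qed
qed

end
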